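(* (a) For a fixed $\beta>1$, the function $\Xi(\alpha,\beta)$ is well defined for every $0<\alpha\le\mathrm{Freq}(\beta)$, and the bound $\mathrm{Freq}(\beta)$ is best possible (i.e. $\Xi(\alpha,\beta)$ is not defined for $\alpha>\mathrm{Freq}(\beta)$). (b) For a fixed $\alpha>0$, the function $\Xi(\alpha,\beta)$ is well defined for every $\beta\ge\Delta(\alpha)$, and the bound $\Delta(\alpha)$ is best possible (i.e. $\Xi(\alpha,\beta)$ is not defined for $1<\beta<\Delta(\alpha)$). (c) In particular, if $\overline{d}_\beta(1)$ is a mechanical word of slope $\alpha_0$, then $\Xi(\alpha,\beta)$ is well defined for all $0<\alpha\le\alpha_0$.
   Context: Define $\langle t\rangle=\{t\}$ (fractional part) if $t\notin\mathbb{Z}$ and $\langle t\rangle=1$ if $t\in\mathbb{Z}$. For $\beta>1$, $\overline{T}_\beta(x)=\langle\beta x\rangle$ on $[0,1]$, and the $\overline{\beta}$-expansion of $x\in[0,1]$ is $\overline{d}_\beta(x)=(x_i)_{i\ge1}$ with $x_i=\lceil\beta\overline{T}_\beta^{i-1}(x)\rceil-1$. A $\overline{T}_\beta$-orbit closure is the closure of $\{\overline{T}_\beta^n(x):n\ge0\}$; it is invariant if $\overline{T}_\beta(S)=S$. The frequency of $x$ is $\lim_{n\to\infty}\frac1n\sum_{k=1}^na_k$ where $\overline{d}_\beta(x)=a_1a_2\cdots$; a set has frequency $\alpha$ if all its elements do. Mechanical words: for real $\alpha\ge0$, $\rho\in[0,1]$, $s_{\alpha,\rho}$ and $s'_{\alpha,\rho}$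 are the infinite words with $n$-th letters ($n\ge0$) $\lfloor\alpha(n+1)+\rho\rfloor-\lfloor\alpha n+\rho\rfloor$ and $\lceil\alpha(n+1)+\rho\rceil-\lceil\alpha n+\rho\rceil$; $\alpha$ is the slope. $\Xi$: for $\alpha>0,\beta>1$, $\Xi(\alpha,\beta)$ is well defined if there exists an invariant $\overline{T}_\beta$-orbit closure contained in some interval $[t,t+\frac1\beta]\subset[0,1]$ and having frequency $\alpha$ (such a closure is then unique); $\Xi(\alpha,\beta)$ is the maximum of that orbit closure. $\Delta$: for $\alpha>0$, $\Delta(\alpha)$ is the real $\beta>1$ with $\overline{d}_\beta(1)=s'_{\alpha,0}$. $\mathrm{Freq}$: for integer $\beta\ge2$, $\mathrm{Freq}(\beta)=\beta-1$; for non-integer $\beta>1$, $\mathrm{Freq}(\beta)$ is the frequency of the unique invariant $\overline{T}_\beta$-orbit closure contained in the interval $[1-\frac1\beta,1]$ (equivalently, writing $\overline{d}_\beta(1)=bs$ with $b=\lfloor\beta\rfloor$, it is the frequency of the unique invariant orbit closure contained in $[t,t+\frac1\beta]$ where $\overline{d}_\beta(t)=(b-1)s$). *)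

theory Defs
  imports "HOL-Analysis.Analysis"
begin

definition ang :: "real \<Rightarrow> real" where
  "ang t = (if t \<in> \<int> then 1 else frac t)"

text \<open>The map is only meant on \<open>[0,1]\<close>, which it maps into itself; note that it sends \<open>0\<close> to \<open>1\<close>.\<close>

definition Tbar :: "real \<Rightarrow> real \<Rightarrow> real" where
  "Tbar \<beta> x = ang (\<beta> * x)"

text \<open>Infinite words are functions on \<^typ>\<open>nat\<close> indexed from 0: the letter \<open>dbar \<beta> x n\<close> is
  the digit usually written \<open>x\<^sub>n\<^sub>+\<^sub>1\<close>.\<close>

definition dbar :: "real \<Rightarrow> real \<Rightarrow> nat \<Rightarrow> int" where
  "dbar \<beta> x n = \<lceil>\<beta> * (Tbar \<beta> ^^ n) x\<rceil> - 1"

definition orbit_closure :: "real \<Rightarrow> real set \<Rightarrow> bool" where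
  "orbit_closure \<beta> S \<longleftrightarrow> (\<exists>x\<in>{0..1}. S = closure {(Tbar \<beta> ^^ n) x | n. True})"

definition invariant_orbit_closure :: "real \<Rightarrow> real set \<Rightarrow> bool" where
  "invariant_orbit_closure \<beta> S \<longleftrightarrow> orbit_closure \<beta> S \<and> Tbar \<beta> ` S = S"

definition point_has_frequency :: "real \<Rightarrow> real \<Rightarrow> real \<Rightarrow> bool" where
  "point_has_frequency \<beta> x \<alpha> \<longleftrightarrow>
     (\<lambda>n. (1 / real n) * (\<Sum>k<n. real_of_int (dbar \<beta> x k))) \<longlonglongrightarrow> \<alpha>"

definition set_has_frequency :: "real \<Rightarrow> real set \<Rightarrow> real \<Rightarrow> bool" where
  "set_has_frequency \<beta> S \<alpha> \<longleftrightarrow> (\<forall>x\<in>S. point_has_frequency \<beta> x \<alpha>)"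

definition mech_lower :: "real \<Rightarrow> real \<Rightarrow> nat \<Rightarrow> int" where
  "mech_lower \<alpha> \<rho> n = \<lfloor>\<alpha> * (real n + 1) + \<rho>\<rfloor> - \<lfloor>\<alpha> * real n + \<rho>\<rfloor>"

definition mech_upper :: "real \<Rightarrow> real \<Rightarrow> nat \<Rightarrow> int" where
  "mech_upper \<alpha> \<rho> n = \<lceil>\<alpha> * (real n + 1) + \<rho>\<rceil> - \<lceil>\<alpha> * real n + \<rho>\<rceil>"

definition mechanical_word :: "real \<Rightarrow> (nat \<Rightarrow> int) \<Rightarrow> bool" where
  "mechanical_word \<alpha> w \<longleftrightarrow>
     \<alpha> \<ge> 0 \<and> (\<exists>\<rho>\<in>{0..1}. w = mech_lower \<alpha> \<rho> \<or> w = mech_upper \<alpha> \<rho>)"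

definition Xi_closure :: "real \<Rightarrow> real \<Rightarrow> real set \<Rightarrow> bool" where
  "Xi_closure \<alpha> \<beta> S \<longleftrightarrow>
     invariant_orbit_closure \<beta> S \<and>
     (\<exists>t. {t..t + 1 / \<beta>} \<subseteq> {0..1} \<and> S \<subseteq> {t..t + 1 / \<beta>}) \<and>
     set_has_frequency \<beta> S \<alpha>"

definition Xi_well_defined :: "real \<Rightarrow> real \<Rightarrow> bool" where
  "Xi_well_defined \<alpha> \<beta> \<longleftrightarrow> (\<exists>S. Xi_closure \<alpha> \<beta> S)"

text \<open>The value is meaningful only where \<^const>\<open>Xi_well_defined\<close> holds.\<close>

definition Xi :: "real \<Rightarrow> real \<Rightarrow> real" where
  "Xi \<alpha> \<beta> = (GREATEST x. x \<in> (THE S. Xi_closure \<alpha> \<beta> S))"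

definition Delta :: "real \<Rightarrow> real" where
  "Delta \<alpha> = (THE \<beta>. \<beta> > 1 \<and> dbar \<beta> 1 = mech_upper \<alpha> 0)"

definition Freq :: "real \<Rightarrow> real" where
  "Freq \<beta> =
     (if \<beta> \<in> \<int> then \<beta> - 1
      else (THE \<alpha>. set_has_frequency \<beta>
              (THE S. invariant_orbit_closure \<beta> S \<and> S \<subseteq> {1 - 1 / \<beta>..1}) \<alpha>))"

end

theory Submission
  imports Defs
begin

text \<open>For \<open>\<alpha> > 0\<close> and \<open>\<beta> > 1\<close> let \<open>M(\<alpha>,\<beta>) = (1 - 1/\<beta>) \<Sum>\<^sub>n \<lceil>\<alpha> n\<rceil> \<beta>\<^sup>-\<^sup>n\<close>, which by summation by parts is
  the value in base \<open>\<beta>\<close> of the word \<open>s'\<close> of slope \<open>\<alpha>\<close> and intercept \<open>0\<close>. All three parts follow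
  from the equivalence of \<open>M(\<alpha>,\<beta>) \<le> 1\<close> with the existence of the closure defining \<open>\<Xi>(\<alpha>,\<beta>)\<close>.

  If \<open>M(\<alpha>,\<beta>) \<le> 1\<close>, the orbit of \<open>M(\<alpha>,\<beta>)\<close> consists of the values of the shifts of \<open>s'\<close>. They lie
  in an interval of length \<open>1/\<beta>\<close> bounded away from \<open>0\<close>, so the map is continuous on their closure.
  Conversely, on an invariant set inside an interval of length \<open>1/\<beta>\<close> the digit sums of length \<open>n\<close> are
  monotone in the point and differ by at most \<open>1\<close>. Hence those of the maximum are subadditive in \<open>n\<close>,
  so at least \<open>\<lceil>\<alpha> n\<rceil>\<close>, and the maximum is at least \<open>M(\<alpha>,\<beta>)\<close>.

  \<open>M\<close> is strictly monotone in both arguments. \<open>\<Delta>(\<alpha>)\<close> is the root of \<open>M(\<alpha>,\<cdot>) = 1\<close>, and \<open>Freq(\<beta>)\<close> is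
  the largest \<open>\<alpha>\<close> with \<open>M(\<alpha>,\<beta>) \<le> 1\<close>: the right-hand limit of \<open>M\<close> there is at least \<open>1\<close>, which says
  that the minimum of the corresponding closure is at least \<open>1 - 1/\<beta>\<close>.\<close>

section \<open>Weighted sums of sequences of linear growth\<close>

definition lin_bounded :: "(nat \<Rightarrow> real) \<Rightarrow> bool" where
  "lin_bounded A \<longleftrightarrow> (\<exists>C. \<forall>n. \<bar>A n\<bar> \<le> C * (real n + 1))"

text \<open>The factor \<open>1 - z\<close> is summation by parts. If \<open>A\<close> lists the
  partial sums of a word, starting with \<open>A 0 = 0\<close>, this is the value of the word in
  base \<open>1 / z\<close>; comparing values then reduces to comparing partial sums
  termwise.\<close>

definition wsum :: "real \<Rightarrow> (nat \<Rightarrow> real) \<Rightarrow> real" where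
  "wsum z A = (1 - z) * (\<Sum>n. A n * z ^ n)"

lemma lin_boundedI:
  assumes "\<And>n. \<bar>A n\<bar> \<le> C * (real n + 1)"
  shows "lin_bounded A"
  using assms unfolding lin_bounded_def by blast

lemma summable_Suc_mult_power:
  fixes z :: real
  assumes "0 \<le> z" "z < 1"
  shows "summable (\<lambda>n. C * (real n + 1) * z ^ n)"
proof -
  have "summable (\<lambda>n. real (Suc n) * z ^ n)"
    using geometric_deriv_sums[of z] assms by (intro sums_summable) auto
  then have "summable (\<lambda>n. C * (real (Suc n) * z ^ n))"
    by (rule summable_mult)
  then show ?thesis by (simp add: algebra_simps)
qed

lemma lin_bounded_summable:
  assumes "lin_bounded A" "0 \<le> z" "z < 1"
  shows "summable (\<lambda>n. A n * z ^ n)"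
proof -
  obtain C where C: "\<bar>A n\<bar> \<le> C * (real n + 1)" for n
    using assms unfolding lin_bounded_def by blast
  show ?thesis
  proof (rule summable_comparison_test')
    show "summable (\<lambda>n. C * (real n + 1) * z ^ n)"
      by (rule summable_Suc_mult_power) (use assms in auto)
    show "norm (A n * z ^ n) \<le> C * (real n + 1) * z ^ n" if "n \<ge> 0" for n
      using C[of n] assms by (auto simp: abs_mult intro!: mult_right_mono)
  qed
qed

lemma lin_bounded_add [intro]:
  assumes "lin_bounded A" "lin_bounded B"
  shows "lin_bounded (\<lambda>n. A n + B n)"
proof -
  obtain C D where "\<bar>A n\<bar> \<le> C * (real n + 1)" "\<bar>B n\<bar> \<le> D * (real n + 1)" for n
    using assms unfolding lin_bounded_def by blast
  then show ?thesis
    by (intro lin_boundedI[where C = "C + D"])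
      (smt (verit, ccfv_threshold) distrib_right)
qed

lemma lin_bounded_const [intro]: "lin_bounded (\<lambda>n. c)"
proof (rule lin_boundedI)
  fix n
  have "\<bar>c\<bar> * 1 \<le> \<bar>c\<bar> * (real n + 1)" by (rule mult_left_mono) auto
  then show "\<bar>c\<bar> \<le> \<bar>c\<bar> * (real n + 1)" by simp
qed

lemma lin_bounded_linear_dist:
  assumes "\<And>n. \<bar>A n - a * real n\<bar> \<le> c"
  shows "lin_bounded A"
proof (rule lin_boundedI)
  fix n
  have "c \<ge> 0" using assms[of 0] by linarith
  have "\<bar>A n\<bar> \<le> \<bar>a * real n\<bar> + c" using assms[of n] by linarith
  also have "\<dots> \<le> (\<bar>a\<bar> + c) * (real n + 1)"
    using \<open>c \<ge> 0\<close> by (simp add: algebra_simps abs_mult)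
  finally show "\<bar>A n\<bar> \<le> (\<bar>a\<bar> + c) * (real n + 1)" .
qed

lemma lin_bounded_Suc [intro]:
  assumes "lin_bounded A"
  shows "lin_bounded (\<lambda>n. A (Suc n))"
proof -
  obtain C where C: "\<bar>A n\<bar> \<le> C * (real n + 1)" for n
    using assms unfolding lin_bounded_def by blast
  have "C \<ge> 0" using C[of 0] by simp
  show ?thesis
  proof (rule lin_boundedI[where C = "2 * C"])
    fix n
    have "\<bar>A (Suc n)\<bar> \<le> C * (real n + 2)" using C[of "Suc n"] by (simp add: algebra_simps)
    also have "\<dots> \<le> C * (2 * (real n + 1))" using \<open>C \<ge> 0\<close> by (intro mult_left_mono) auto
    finally show "\<bar>A (Suc n)\<bar> \<le> 2 * C * (real n + 1)" by (simp add: algebra_simps)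
  qed
qed

lemma wsum_add:
  assumes "lin_bounded A" "lin_bounded B" "0 \<le> z" "z < 1"
  shows "wsum z (\<lambda>n. A n + B n) = wsum z A + wsum z B"
  unfolding wsum_def using assms
  by (simp add: distrib_right distrib_left suminf_add[symmetric] lin_bounded_summable)

lemma wsum_const:
  assumes "0 \<le> z" "z < 1"
  shows "wsum z (\<lambda>n. c) = c"
  using assms by (simp add: wsum_def suminf_mult suminf_geometric summable_geometric)

lemma wsum_mono:
  assumes "lin_bounded A" "lin_bounded B" "0 \<le> z" "z < 1" "\<And>n. A n \<le> B n"
  shows "wsum z A \<le> wsum z B"
  unfolding wsum_def using assms
  by (intro mult_left_mono suminf_le lin_bounded_summable mult_right_mono) auto

lemma wsum_strict_mono:
  assumes "lin_bounded A" "lin_bounded B" "0 < z" "z < 1" "\<And>n. A n \<le> B n" "A m < B m"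
  shows "wsum z A < wsum z B"
proof -
  have sA: "summable (\<lambda>n. A n * z ^ n)" and sB: "summable (\<lambda>n. B n * z ^ n)"
    using assms by (auto intro!: lin_bounded_summable)
  have "0 < (\<Sum>n. B n * z ^ n - A n * z ^ n)"
  proof (rule suminf_pos2)
    show "summable (\<lambda>n. B n * z ^ n - A n * z ^ n)" using sA sB by (rule summable_diff[rotated])
    show "0 \<le> B n * z ^ n - A n * z ^ n" for n
      using assms(5)[of n] assms(3) by (simp add: mult_right_mono)
    show "0 < B m * z ^ m - A m * z ^ m" using assms by simp
  qed
  then have "(\<Sum>n. A n * z ^ n) < (\<Sum>n. B n * z ^ n)"
    using suminf_diff[OF sB sA] by simp
  then show ?thesis unfolding wsum_def using assms by simp
qed

lemma wsum_shift:
  assumes "lin_bounded A" "0 \<le> z" "z < 1" "A 0 = 0"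
  shows "wsum z A = z * wsum z (\<lambda>n. A (Suc n))"
proof -
  have s: "summable (\<lambda>n. A n * z ^ n)" using assms by (auto intro!: lin_bounded_summable)
  have s': "summable (\<lambda>n. A (Suc n) * z ^ n)"
    using assms by (auto intro!: lin_bounded_summable)
  have "(\<Sum>n. A n * z ^ n) = (\<Sum>n. A (Suc n) * z ^ Suc n)"
    using suminf_split_head[OF s] assms(4) by simp
  also have "\<dots> = z * (\<Sum>n. A (Suc n) * z ^ n)"
    using suminf_mult[OF s', of z] by (simp add: algebra_simps)
  finally show ?thesis unfolding wsum_def by simp
qed

lemma lin_bounded_if_pos: "lin_bounded (\<lambda>n. if n = 0 then 0 else c)"
  by (rule lin_bounded_linear_dist[where a = 0 and c = "\<bar>c\<bar>"]) auto

lemma wsum_if_pos: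
  assumes "0 \<le> z" "z < 1"
  shows "wsum z (\<lambda>n. if n = 0 then 0 else c) = c * z"
  using wsum_shift[OF lin_bounded_if_pos assms, of c] wsum_const[OF assms, of c] by simp

lemma lin_bounded_linear: "lin_bounded (\<lambda>n. a * real n)"
  by (rule lin_bounded_linear_dist[where a = a and c = 0]) auto

text \<open>Shifting the index turns the series into the fixed-point equation
  \<open>w = z * (w + a)\<close>.\<close>

lemma wsum_linear:
  assumes "0 \<le> z" "z < 1"
  shows "wsum z (\<lambda>n. a * real n) = a * z / (1 - z)"
proof -
  have "wsum z (\<lambda>n. a * real n) = z * wsum z (\<lambda>n. a * real n + a)"
    using wsum_shift[OF lin_bounded_linear assms, of a] by (simp add: algebra_simps)
  also have "wsum z (\<lambda>n. a * real n + a) = wsum z (\<lambda>n. a * real n) + a"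
    using wsum_add[OF lin_bounded_linear lin_bounded_const assms, of a a] wsum_const[OF assms, of a]
    by simp
  finally show ?thesis using assms by (simp add: field_simps)
qed

lemma wsum_tendsto:
  fixes A :: "nat \<Rightarrow> nat \<Rightarrow> real"
  assumes z: "0 \<le> z" "z < 1"
    and lim: "\<And>n. (\<lambda>j. A j n) \<longlonglongrightarrow> B n"
    and bd: "\<And>j n. \<bar>A j n\<bar> \<le> C * (real n + 1)"
  shows "(\<lambda>j. wsum z (A j)) \<longlonglongrightarrow> wsum z B"
proof -
  have "(\<lambda>j. \<Sum>n. A j n * z ^ n) \<longlonglongrightarrow> (\<Sum>n. B n * z ^ n)"
  proof (rule tannerys_theorem[where M = "\<lambda>n. C * (real n + 1) * z ^ n",
        THEN conjunct2, THEN conjunct2])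
    show "(\<lambda>j. A j k * z ^ k) \<longlonglongrightarrow> B k * z ^ k" for k
      by (intro tendsto_intros lim)
    have "norm (A j k * z ^ k) \<le> C * (real k + 1) * z ^ k" for j k
      using bd[of j k] z by (auto simp: abs_mult intro!: mult_right_mono)
    then show "\<forall>\<^sub>F (k, j) in sequentially \<times>\<^sub>F sequentially. norm (A j k * z ^ k) \<le> C * (real k + 1) * z ^ k"
      by (intro always_eventually) auto
    show "summable (\<lambda>n. C * (real n + 1) * z ^ n)"
      using z by (rule summable_Suc_mult_power)
  qed auto
  then show ?thesis unfolding wsum_def by (intro tendsto_intros)
qed

lemma wsum_increments:
  assumes "lin_bounded A" "0 \<le> z" "z < 1" "A 0 = 0"
  shows "(\<lambda>n. (A (Suc n) - A n) * z ^ Suc n) sums wsum z A"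
proof -
  have s: "summable (\<lambda>n. A n * z ^ n)" using assms by (auto intro!: lin_bounded_summable)
  have s1: "(\<lambda>n. A (Suc n) * z ^ Suc n) sums (\<Sum>n. A n * z ^ n)"
    using sums_Suc_iff[of "\<lambda>n. A n * z ^ n"] summable_sums[OF s] assms(4) by simp
  have s2: "(\<lambda>n. z * (A n * z ^ n)) sums (z * (\<Sum>n. A n * z ^ n))"
    using summable_sums[OF s] by (rule sums_mult)
  show ?thesis
    using sums_diff[OF s1 s2] unfolding wsum_def by (simp add: algebra_simps)
qed

text \<open>The factor \<open>1 - z\<close> decreases in \<open>z\<close>, so monotonicity is hidden
  in the definition. In terms of increments the series has nonnegative coefficients, the first one
  positive, and the comparison is termwise.\<close>

lemma wsum_strict_mono_ratio:
  assumes A: "lin_bounded A" "A 0 = 0" "mono A" "A 1 > 0" and z: "0 \<le> z" "z < z'" "z' < 1"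
  shows "wsum z A < wsum z' A"
proof -
  let ?f = "\<lambda>z n. (A (Suc n) - A n) * z ^ Suc n"
  have "(\<lambda>n. ?f z' n - ?f z n) sums (wsum z' A - wsum z A)"
    using A z by (intro sums_diff wsum_increments) auto
  moreover have "0 < (\<Sum>n. ?f z' n - ?f z n)"
  proof (rule suminf_pos2)
    show "summable (\<lambda>n. ?f z' n - ?f z n)" using calculation by (rule sums_summable)
    show "0 \<le> ?f z' n - ?f z n" for n
    proof -
      have "A n \<le> A (Suc n)" using A(3) by (simp add: monoD)
      moreover have "z ^ Suc n \<le> z' ^ Suc n" using z by (intro power_mono) auto
      ultimately show ?thesis using mult_left_mono[of "z ^ Suc n" "z' ^ Suc n" "A (Suc n) - A n"]
        by simp
    qed
    show "0 < ?f z' 0 - ?f z 0" using A z by simp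
  qed
  ultimately show ?thesis by (simp add: sums_unique[symmetric])
qed

lemma isCont_wsum:
  assumes "lin_bounded A" "0 \<le> z" "z < 1"
  shows "isCont (\<lambda>z. wsum z A) z"
proof -
  have "isCont (\<lambda>z. \<Sum>n. A n * z ^ n) z"
  proof (rule isCont_powser)
    show "summable (\<lambda>n. A n * ((1 + z) / 2) ^ n)"
      using assms by (intro lin_bounded_summable) auto
    show "norm z < norm ((1 + z) / 2)" using assms by auto
  qed
  then show ?thesis unfolding wsum_def by (intro continuous_intros)
qed

section \<open>Digit sums on short invariant sets\<close>

lemma funpow_invariant:
  assumes "f ` S \<subseteq> S" "x \<in> S"
  shows "(f ^^ n) x \<in> S"
  using assms by (induction n) auto

text \<open>The convention for integers makes one formula cover both cases: an integer
  \<open>\<beta> * x\<close> gets the digit one below itself and the remainder 1.\<close>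

lemma Tbar_eq: "Tbar \<beta> x = \<beta> * x - of_int (\<lceil>\<beta> * x\<rceil> - 1)"
proof (cases "\<beta> * x \<in> \<int>")
  case True
  then show ?thesis by (auto simp: Tbar_def ang_def elim!: Ints_cases)
next
  case False
  then have "\<lceil>\<beta> * x\<rceil> = \<lfloor>\<beta> * x\<rfloor> + 1"
    using ceiling_altdef by (metis Ints_of_int)
  then show ?thesis using False by (simp add: Tbar_def ang_def frac_def)
qed

lemma Tbar_bounds: "0 < Tbar \<beta> x" "Tbar \<beta> x \<le> 1"
  unfolding Tbar_eq by linarith+

lemma Tbar_eqI:
  assumes "0 < \<beta> * x - of_int d" "\<beta> * x - of_int d \<le> 1"
  shows "Tbar \<beta> x = \<beta> * x - of_int d"
proof -
  have "\<lceil>\<beta> * x\<rceil> = d + 1" using assms by (intro ceiling_unique) auto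
  then show ?thesis unfolding Tbar_eq by simp
qed

lemma funpow_Tbar_bounds:
  assumes "x \<in> {0..1}"
  shows "(Tbar \<beta> ^^ n) x \<in> {0..1}"
proof (cases n)
  case (Suc m)
  then show ?thesis using Tbar_bounds[of \<beta> "(Tbar \<beta> ^^ m) x"] by simp
qed (use assms in simp)

lemma dbar_eq: "real_of_int (dbar \<beta> x n) = \<beta> * (Tbar \<beta> ^^ n) x - (Tbar \<beta> ^^ Suc n) x"
  unfolding dbar_def by (simp add: Tbar_eq[of \<beta> "(Tbar \<beta> ^^ n) x"])

lemma dbar_shift: "dbar \<beta> ((Tbar \<beta> ^^ m) x) n = dbar \<beta> x (m + n)"
  unfolding dbar_def by (simp add: funpow_add add.commute[of m])

section \<open>Digit sums, frequencies and values of expansions\<close>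

definition dsum :: "real \<Rightarrow> real \<Rightarrow> nat \<Rightarrow> real" where
  "dsum \<beta> x n = (\<Sum>k<n. real_of_int (dbar \<beta> x k))"

lemma dsum_0 [simp]: "dsum \<beta> x 0 = 0"
  by (simp add: dsum_def)

lemma dsum_Suc: "dsum \<beta> x (Suc n) = dsum \<beta> x n + real_of_int (dbar \<beta> x n)"
  by (simp add: dsum_def)

lemma dsum_add: "dsum \<beta> x (m + n) = dsum \<beta> x m + dsum \<beta> ((Tbar \<beta> ^^ m) x) n"
  by (induction n) (simp_all add: dsum_Suc dbar_shift)

lemma dsum_Ints: "dsum \<beta> x n \<in> \<int>"
  by (induction n) (auto simp: dsum_Suc)

lemma point_has_frequency_iff:
  "point_has_frequency \<beta> x \<alpha> \<longleftrightarrow> (\<lambda>n. dsum \<beta> x n / real n) \<longlonglongrightarrow> \<alpha>"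
  by (simp add: point_has_frequency_def dsum_def)

lemma bounded_over_n_tendsto_0:
  assumes "\<And>n. \<bar>f n\<bar> \<le> c"
  shows "(\<lambda>n. f n / real n) \<longlonglongrightarrow> 0"
proof (rule Lim_null_comparison)
  show "\<forall>\<^sub>F n in sequentially. norm (f n / real n) \<le> c / real n"
    using assms by (intro always_eventually allI) (simp add: divide_right_mono)
  show "(\<lambda>n. c / real n) \<longlonglongrightarrow> 0" by (rule lim_const_over_n)
qed

lemma point_has_frequencyI:
  assumes "\<And>n. \<bar>dsum \<beta> x n - \<alpha> * real n\<bar> \<le> c"
  shows "point_has_frequency \<beta> x \<alpha>"
proof -
  have "(\<lambda>n. (dsum \<beta> x n - \<alpha> * real n) / real n + \<alpha>) \<longlonglongrightarrow> 0 + \<alpha>"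
    using assms by (intro tendsto_add bounded_over_n_tendsto_0 tendsto_const)
  moreover have "\<forall>\<^sub>F n in sequentially. (dsum \<beta> x n - \<alpha> * real n) / real n + \<alpha> = dsum \<beta> x n / real n"
    using eventually_gt_at_top[of 0] by eventually_elim (simp add: field_simps)
  ultimately show ?thesis unfolding point_has_frequency_iff by (simp add: tendsto_cong)
qed

lemma point_has_frequency_transfer:
  assumes "point_has_frequency \<beta> x \<alpha>" and "\<And>n. \<bar>dsum \<beta> y n - dsum \<beta> x n\<bar> \<le> c"
  shows "point_has_frequency \<beta> y \<alpha>"
proof -
  have "(\<lambda>n. dsum \<beta> x n / real n + (dsum \<beta> y n - dsum \<beta> x n) / real n) \<longlonglongrightarrow> \<alpha> + 0"
    using assms unfolding point_has_frequency_iff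
    by (intro tendsto_add bounded_over_n_tendsto_0)
  then show ?thesis unfolding point_has_frequency_iff by (simp add: diff_divide_distrib)
qed

text \<open>A digit is \<open>\<beta>\<close> times an orbit point minus the next orbit point. The
  bound is two-sided because the point 0 has first digit -1.\<close>

lemma abs_dsum_le:
  assumes "\<beta> > 1" "x \<in> {0..1}"
  shows "\<bar>dsum \<beta> x n\<bar> \<le> (\<beta> + 1) * real n"
proof (induction n)
  case (Suc n)
  have "\<bar>real_of_int (dbar \<beta> x n)\<bar> \<le> \<beta> + 1"
  proof -
    have "(Tbar \<beta> ^^ n) x \<in> {0..1}" "(Tbar \<beta> ^^ Suc n) x \<in> {0..1}"
      using funpow_Tbar_bounds[OF assms(2)] by blast+
    moreover have "\<beta> * (Tbar \<beta> ^^ n) x \<le> \<beta> * 1" "0 \<le> \<beta> * (Tbar \<beta> ^^ n) x"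
      using calculation assms by (auto intro!: mult_left_mono)
    ultimately show ?thesis unfolding dbar_eq by auto
  qed
  then show ?case using Suc by (simp add: dsum_Suc algebra_simps)
qed simp

lemma lin_bounded_dsum:
  assumes "\<beta> > 1" "x \<in> {0..1}"
  shows "lin_bounded (dsum \<beta> x)"
proof (rule lin_boundedI)
  fix n
  have "\<bar>dsum \<beta> x n\<bar> \<le> (\<beta> + 1) * real n" by (rule abs_dsum_le[OF assms])
  also have "\<dots> \<le> (\<beta> + 1) * (real n + 1)" using assms by (intro mult_left_mono) auto
  finally show "\<bar>dsum \<beta> x n\<bar> \<le> (\<beta> + 1) * (real n + 1)" .
qed

text \<open>A point is the value of its own expansion: the first \<open>N\<close> terms telescope to
  \<open>x\<close> minus a remainder, which decays geometrically because the orbit stays in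
  [0,1].\<close>

lemma wsum_dsum:
  assumes "\<beta> > 1" "x \<in> {0..1}"
  shows "wsum (1 / \<beta>) (dsum \<beta> x) = x"
proof -
  define z where "z = 1 / \<beta>"
  have z: "0 \<le> z" "z < 1" "\<beta> * z = 1" using assms by (auto simp: z_def)
  have part: "(\<Sum>n<N. (dsum \<beta> x (Suc n) - dsum \<beta> x n) * z ^ Suc n) = x - (Tbar \<beta> ^^ N) x * z ^ N" for N
  proof (induction N)
    case (Suc N)
    have "(dsum \<beta> x (Suc N) - dsum \<beta> x N) * z ^ Suc N =
        (\<beta> * z) * ((Tbar \<beta> ^^ N) x * z ^ N) - (Tbar \<beta> ^^ Suc N) x * z ^ Suc N"
      unfolding dsum_Suc dbar_eq power_Suc by algebra
    then show ?case unfolding sum.lessThan_Suc Suc z(3) by linarith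
  qed simp
  have bd: "norm ((Tbar \<beta> ^^ N) x * z ^ N) \<le> z ^ N" for N
  proof -
    have "0 \<le> (Tbar \<beta> ^^ N) x" "(Tbar \<beta> ^^ N) x \<le> 1"
      using funpow_Tbar_bounds[OF assms(2), where \<beta> = \<beta> and n = N] by auto
    then have "\<bar>(Tbar \<beta> ^^ N) x\<bar> * z ^ N \<le> 1 * z ^ N"
      using z by (intro mult_right_mono) auto
    then show ?thesis using z by (simp add: abs_mult)
  qed
  have "(\<lambda>N. (Tbar \<beta> ^^ N) x * z ^ N) \<longlonglongrightarrow> 0"
    by (rule Lim_null_comparison[OF always_eventually LIMSEQ_realpow_zero]) (use bd z in auto)
  then have "(\<lambda>N. x - (Tbar \<beta> ^^ N) x * z ^ N) \<longlonglongrightarrow> x - 0"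
    by (intro tendsto_diff tendsto_const)
  then have "(\<lambda>n. (dsum \<beta> x (Suc n) - dsum \<beta> x n) * z ^ Suc n) sums x"
    unfolding sums_def part diff_zero .
  moreover have "(\<lambda>n. (dsum \<beta> x (Suc n) - dsum \<beta> x n) * z ^ Suc n) sums wsum z (dsum \<beta> x)"
    by (rule wsum_increments[OF lin_bounded_dsum[OF assms] z(1,2) dsum_0])
  ultimately show ?thesis unfolding z_def[symmetric] by (rule sums_unique2[symmetric])
qed

text \<open>A diameter bound that names no interval, so that it can be used for orbits and for the
  union of two closures as well.\<close>

definition short :: "real \<Rightarrow> real set \<Rightarrow> bool" where
  "short \<beta> S \<longleftrightarrow> (\<forall>x\<in>S. \<forall>y\<in>S. y - x \<le> 1 / \<beta>)"

lemma short_subset_interval: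
  assumes "S \<subseteq> {t..t + 1 / \<beta>}"
  shows "short \<beta> S"
  unfolding short_def
proof (intro ballI)
  fix x y assume "x \<in> S" "y \<in> S"
  then have "t \<le> x" "y \<le> t + 1 / \<beta>" using assms by auto
  then show "y - x \<le> 1 / \<beta>" by linarith
qed

text \<open>Multiplication by \<open>\<beta>\<close> stretches the distance to at most 1, so at most
  one digit boundary is crossed, and crossing it reverses the order of the images.\<close>

lemma Tbar_step:
  assumes "\<beta> > 1" "x \<le> y" "y - x \<le> 1 / \<beta>"
  defines "D \<equiv> (\<lceil>\<beta> * y\<rceil> - \<lceil>\<beta> * x\<rceil>)"
  shows "(D = 0 \<and> Tbar \<beta> y - Tbar \<beta> x = \<beta> * (y - x)) \<or> (D = 1 \<and> Tbar \<beta> x - Tbar \<beta> y = 1 - \<beta> * (y - x))"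
proof -
  have "0 \<le> \<beta> * (y - x)" using assms(1,2) by simp
  moreover have "\<beta> * (y - x) \<le> 1" using mult_left_mono[OF assms(3), of \<beta>] assms(1) by simp
  ultimately have xy: "0 \<le> \<beta> * y - \<beta> * x" "\<beta> * y - \<beta> * x \<le> 1"
    by (simp_all add: right_diff_distrib)
  have "D = 0 \<or> D = 1" unfolding D_def using xy by linarith
  moreover have "Tbar \<beta> y - Tbar \<beta> x = \<beta> * (y - x) - of_int D"
    by (simp add: Tbar_eq D_def algebra_simps)
  ultimately show ?thesis by auto
qed

text \<open>The induction couples digit sums with order. A digit difference swaps the two points,
  and the next one must swap them back with the opposite sign, so the accumulated difference only
  alternates between 0 and 1.\<close>

lemma dsum_order:
  assumes \<beta>: "\<beta> > 1" and S: "short \<beta> S" "Tbar \<beta> ` S \<subseteq> S" and x: "x \<in> S" "y \<in> S" "x \<le> y"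
  shows "(dsum \<beta> y n = dsum \<beta> x n \<and> (Tbar \<beta> ^^ n) x \<le> (Tbar \<beta> ^^ n) y) \<or>
         (dsum \<beta> y n = dsum \<beta> x n + 1 \<and> (Tbar \<beta> ^^ n) y \<le> (Tbar \<beta> ^^ n) x)"
proof (induction n)
  case (Suc n)
  let ?x = "(Tbar \<beta> ^^ n) x" and ?y = "(Tbar \<beta> ^^ n) y"
  have "?x \<in> S" "?y \<in> S" using funpow_invariant[OF S(2)] x by auto
  then have le: "?y - ?x \<le> 1 / \<beta>" "?x - ?y \<le> 1 / \<beta>" using S(1) by (auto simp: short_def)
  have nn: "0 \<le> 1 - \<beta> * (?y - ?x)" "0 \<le> 1 - \<beta> * (?x - ?y)"
    using mult_left_mono[OF le(1), of \<beta>] mult_left_mono[OF le(2), of \<beta>] \<beta> by simp_all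
  from Suc show ?case
  proof (elim disjE conjE)
    assume "dsum \<beta> y n = dsum \<beta> x n" "?x \<le> ?y"
    moreover have "0 \<le> \<beta> * (?y - ?x)" using \<beta> \<open>?x \<le> ?y\<close> by simp
    ultimately show ?thesis
      using Tbar_step[OF \<beta> \<open>?x \<le> ?y\<close> le(1)] nn by (auto simp: dsum_Suc dbar_def)
  next
    assume "dsum \<beta> y n = dsum \<beta> x n + 1" "?y \<le> ?x"
    moreover have "0 \<le> \<beta> * (?x - ?y)" using \<beta> \<open>?y \<le> ?x\<close> by simp
    ultimately show ?thesis
      using Tbar_step[OF \<beta> \<open>?y \<le> ?x\<close> le(2)] nn by (auto simp: dsum_Suc dbar_def)
  qed
qed (use x in simp)

lemma dsum_mono:
  assumes "\<beta> > 1" "short \<beta> S" "Tbar \<beta> ` S \<subseteq> S" "x \<in> S" "y \<in> S" "x \<le> y"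
  shows "dsum \<beta> x n \<le> dsum \<beta> y n" "dsum \<beta> y n \<le> dsum \<beta> x n + 1"
  using dsum_order[OF assms, of n] by auto

lemma dsum_balanced:
  assumes "\<beta> > 1" "short \<beta> S" "Tbar \<beta> ` S \<subseteq> S" "x \<in> S" "y \<in> S"
  shows "\<bar>dsum \<beta> y n - dsum \<beta> x n\<bar> \<le> 1"
proof (cases "x \<le> y")
  case True
  then show ?thesis using dsum_mono[OF assms(1-5) True, of n] by linarith
next
  case False
  then show ?thesis using dsum_mono[OF assms(1-3) assms(5,4), of n] by linarith
qed

lemma frequency_multiples:
  assumes "point_has_frequency \<beta> x \<alpha>" "n > 0"
  shows "(\<lambda>k. dsum \<beta> x (k * n) / real k) \<longlonglongrightarrow> \<alpha> * real n"
proof -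
  have "strict_mono (\<lambda>k. k * n)" using assms(2) by (simp add: strict_mono_def)
  then have "(\<lambda>k. dsum \<beta> x (k * n) / real (k * n)) \<longlonglongrightarrow> \<alpha>"
    using LIMSEQ_subseq_LIMSEQ[OF assms(1)[unfolded point_has_frequency_iff], of "\<lambda>k. k * n"]
    by (simp add: o_def)
  then have "(\<lambda>k. dsum \<beta> x (k * n) / real (k * n) * real n) \<longlonglongrightarrow> \<alpha> * real n"
    by (intro tendsto_mult tendsto_const)
  then show ?thesis using assms(2) by simp
qed

text \<open>The digit sums of the largest point are subadditive, those of the smallest superadditive.\<close>

lemma dsum_max_ge:
  assumes \<beta>: "\<beta> > 1" and S: "short \<beta> S" "Tbar \<beta> ` S \<subseteq> S"
    and m: "m \<in> S" "\<And>x. x \<in> S \<Longrightarrow> x \<le> m" and freq: "point_has_frequency \<beta> m \<alpha>"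
  shows "\<alpha> * real n \<le> dsum \<beta> m n"
proof (cases "n = 0")
  case False
  have mult: "dsum \<beta> m (k * n) \<le> real k * dsum \<beta> m n" for k
  proof (induction k)
    case (Suc k)
    have y: "(Tbar \<beta> ^^ (k * n)) m \<in> S" using S m by (intro funpow_invariant)
    have "dsum \<beta> m (Suc k * n) = dsum \<beta> m (k * n) + dsum \<beta> ((Tbar \<beta> ^^ (k * n)) m) n"
      by (simp add: dsum_add[symmetric] add.commute)
    also have "dsum \<beta> ((Tbar \<beta> ^^ (k * n)) m) n \<le> dsum \<beta> m n"
      by (rule dsum_mono(1)[OF \<beta> S y m(1) m(2)[OF y]])
    finally show ?case using Suc by (simp add: algebra_simps)
  qed simp
  show ?thesis
  proof (rule LIMSEQ_le_const2[OF frequency_multiples[OF freq]])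
    show "\<exists>N. \<forall>k\<ge>N. dsum \<beta> m (k * n) / real k \<le> dsum \<beta> m n"
      using mult by (intro exI[of _ 1]) (auto simp: field_simps)
  qed (use False in simp)
qed simp

lemma dsum_min_le:
  assumes \<beta>: "\<beta> > 1" and S: "short \<beta> S" "Tbar \<beta> ` S \<subseteq> S"
    and m: "m \<in> S" "\<And>x. x \<in> S \<Longrightarrow> m \<le> x" and freq: "point_has_frequency \<beta> m \<alpha>"
  shows "dsum \<beta> m n \<le> \<alpha> * real n"
proof (cases "n = 0")
  case False
  have mult: "real k * dsum \<beta> m n \<le> dsum \<beta> m (k * n)" for k
  proof (induction k)
    case (Suc k)
    have y: "(Tbar \<beta> ^^ (k * n)) m \<in> S" using S m by (intro funpow_invariant)
    have "dsum \<beta> m n \<le> dsum \<beta> ((Tbar \<beta> ^^ (k * n)) m) n"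
      by (rule dsum_mono(1)[OF \<beta> S m(1) y m(2)[OF y]])
    moreover have "dsum \<beta> m (Suc k * n) = dsum \<beta> m (k * n) + dsum \<beta> ((Tbar \<beta> ^^ (k * n)) m) n"
      by (simp add: dsum_add[symmetric] add.commute)
    ultimately show ?case using Suc by (simp add: algebra_simps)
  qed simp
  show ?thesis
  proof (rule LIMSEQ_le_const[OF frequency_multiples[OF freq]])
    show "\<exists>N. \<forall>k\<ge>N. dsum \<beta> m n \<le> dsum \<beta> m (k * n) / real k"
      using mult by (intro exI[of _ 1]) (auto simp: field_simps)
  qed (use False in simp)
qed simp

section \<open>Closures of mechanical orbits\<close>

definition orbit :: "real \<Rightarrow> real \<Rightarrow> real set" where
  "orbit \<beta> x = range (\<lambda>n. (Tbar \<beta> ^^ n) x)"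

lemma orbit_closure_iff: "orbit_closure \<beta> S \<longleftrightarrow> (\<exists>x\<in>{0..1}. S = closure (orbit \<beta> x))"
  by (simp add: orbit_closure_def orbit_def full_SetCompr_eq)

lemma Tbar_orbit: "Tbar \<beta> ` orbit \<beta> x \<subseteq> orbit \<beta> x"
proof
  fix y assume "y \<in> Tbar \<beta> ` orbit \<beta> x"
  then obtain n where "y = (Tbar \<beta> ^^ Suc n) x" by (auto simp: orbit_def)
  then show "y \<in> orbit \<beta> x" unfolding orbit_def by blast
qed

text \<open>The map jumps down to \<open>0\<close>, so it is continuous along sets whose images stay away from \<open>0\<close>.\<close>

lemma Tbar_local:
  assumes "e \<le> Tbar \<beta> y'" "\<bar>\<beta> * (y' - y)\<bar> < e" "\<bar>\<beta> * (y' - y)\<bar> < Tbar \<beta> y"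
  shows "Tbar \<beta> y' - Tbar \<beta> y = \<beta> * (y' - y)"
proof -
  define d d' where "d = \<lceil>\<beta> * y\<rceil> - 1" and "d' = \<lceil>\<beta> * y'\<rceil> - 1"
  have eq: "Tbar \<beta> y' - Tbar \<beta> y = \<beta> * (y' - y) + of_int (d - d')"
    by (simp add: Tbar_eq d_def d'_def algebra_simps)
  have "d - d' < 1" "d - d' > -1"
    using eq assms Tbar_bounds[of \<beta> y] Tbar_bounds[of \<beta> y'] by linarith+
  then have "d = d'" by simp
  then show ?thesis using eq by simp
qed

lemma Tbar_near:
  assumes "\<beta> > 1" "e > 0" "r > 0"
  obtains \<delta> where "\<delta> > 0"
    "\<And>y'. \<bar>y' - y\<bar> < \<delta> \<Longrightarrow> e \<le> Tbar \<beta> y' \<Longrightarrow> \<bar>Tbar \<beta> y' - Tbar \<beta> y\<bar> < r"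
proof
  let ?m = "min r (min e (Tbar \<beta> y))"
  show "?m / \<beta> > 0" using assms Tbar_bounds[of \<beta> y] by simp
  fix y' assume y': "\<bar>y' - y\<bar> < ?m / \<beta>" "e \<le> Tbar \<beta> y'"
  have "\<bar>\<beta> * (y' - y)\<bar> = \<beta> * \<bar>y' - y\<bar>" using assms by (simp add: abs_mult)
  also have "\<dots> < ?m" using y' assms by (simp add: field_simps)
  finally have "\<bar>\<beta> * (y' - y)\<bar> < ?m" .
  then show "\<bar>Tbar \<beta> y' - Tbar \<beta> y\<bar> < r"
    using Tbar_local[OF y'(2), of y] by simp
qed

text \<open>Invariance could fail at a limit only when a discontinuity is approached from the right,
  where images tend to 0. Points of \<open>S\<close> have images in \<open>S\<close>, hence at least
  \<open>e\<close>, which excludes this.\<close>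

lemma Tbar_closure:
  assumes \<beta>: "\<beta> > 1" and S: "Tbar \<beta> ` S \<subseteq> S" "closure S \<subseteq> {e..}" "e > 0"
  shows "Tbar \<beta> ` closure S \<subseteq> closure S"
proof (rule image_subsetI)
  fix y assume y: "y \<in> closure S"
  show "Tbar \<beta> y \<in> closure S"
    unfolding closure_approachable
  proof (intro allI impI)
    fix r :: real assume "r > 0"
    obtain \<delta> where \<delta>: "\<delta> > 0"
      "\<And>y'. \<bar>y' - y\<bar> < \<delta> \<Longrightarrow> e \<le> Tbar \<beta> y' \<Longrightarrow> \<bar>Tbar \<beta> y' - Tbar \<beta> y\<bar> < r"
      using Tbar_near[OF \<beta> S(3) \<open>r > 0\<close>] by metis
    obtain y' where y': "y' \<in> S" "\<bar>y' - y\<bar> < \<delta>"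
      using y \<delta>(1) unfolding closure_approachable dist_real_def by blast
    moreover have "Tbar \<beta> y' \<in> S" using y' S by auto
    ultimately have "\<bar>Tbar \<beta> y' - Tbar \<beta> y\<bar> < r"
      using \<delta>(2) S(2) closure_subset by blast
    then show "\<exists>u\<in>S. dist u (Tbar \<beta> y) < r"
      using \<open>Tbar \<beta> y' \<in> S\<close> by (auto simp: dist_real_def)
  qed
qed

lemma continuous_on_Tbar:
  assumes \<beta>: "\<beta> > 1" and S: "Tbar \<beta> ` S \<subseteq> S" "S \<subseteq> {e..}" "e > 0"
  shows "continuous_on S (Tbar \<beta>)"
  unfolding continuous_on_iff
proof (intro ballI allI impI)
  fix y and r :: real assume "y \<in> S" "r > 0"
  obtain \<delta> where \<delta>: "\<delta> > 0"
    "\<And>y'. \<bar>y' - y\<bar> < \<delta> \<Longrightarrow> e \<le> Tbar \<beta> y' \<Longrightarrow> \<bar>Tbar \<beta> y' - Tbar \<beta> y\<bar> < r"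
    using Tbar_near[OF \<beta> S(3) \<open>r > 0\<close>] by metis
  then show "\<exists>\<delta>>0. \<forall>y'\<in>S. dist y' y < \<delta> \<longrightarrow> dist (Tbar \<beta> y') (Tbar \<beta> y) < r"
    using S by (intro exI[of _ \<delta>]) (auto simp: dist_real_def)
qed

lemma continuous_on_funpow_Tbar:
  assumes \<beta>: "\<beta> > 1" and S: "Tbar \<beta> ` S \<subseteq> S" "S \<subseteq> {e..}" "e > 0"
  shows "continuous_on S (Tbar \<beta> ^^ n)"
proof (induction n)
  case (Suc n)
  have "(Tbar \<beta> ^^ n) ` S \<subseteq> S" using funpow_invariant[OF S(1)] by blast
  then have "continuous_on ((Tbar \<beta> ^^ n) ` S) (Tbar \<beta>)"
    using continuous_on_Tbar[OF assms] continuous_on_subset by blast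
  then have "continuous_on S (Tbar \<beta> \<circ> (Tbar \<beta> ^^ n))" by (rule continuous_on_compose[OF Suc])
  then show ?case by simp
qed simp

text \<open>Each digit is a linear combination of two consecutive iterates, so it inherits their
  continuity; being integer valued, it is locally constant on \<open>S\<close>.\<close>

lemma continuous_on_dsum:
  assumes \<beta>: "\<beta> > 1" and S: "Tbar \<beta> ` S \<subseteq> S" "S \<subseteq> {e..}" "e > 0"
  shows "continuous_on S (\<lambda>x. dsum \<beta> x n)"
  unfolding dsum_def dbar_eq
  by (intro continuous_intros continuous_on_funpow_Tbar[OF assms])

section \<open>One-sided limits of ceilings and the values of mechanical words\<close>

lemma tendsto_ceiling_left:
  fixes u :: "nat \<Rightarrow> real"
  assumes "u \<longlonglongrightarrow> l" "\<And>j. u j \<le> l"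
  shows "(\<lambda>j. real_of_int \<lceil>u j\<rceil>) \<longlonglongrightarrow> of_int \<lceil>l\<rceil>"
proof (rule tendsto_eventually)
  have "\<forall>\<^sub>F j in sequentially. u j > of_int \<lceil>l\<rceil> - 1"
    using assms(1) by (rule order_tendstoD) linarith
  then show "\<forall>\<^sub>F j in sequentially. real_of_int \<lceil>u j\<rceil> = of_int \<lceil>l\<rceil>"
  proof eventually_elim
    case (elim j)
    have "\<lceil>u j\<rceil> = \<lceil>l\<rceil>"
      by (rule ceiling_unique) (use elim assms(2)[of j] in linarith)+
    then show ?case by simp
  qed
qed

text \<open>The limit exceeds the ceiling of \<open>l\<close> by one exactly when \<open>l\<close>
  is an integer; this produces the jumps of \<open>upper_val\<close> in the slope.\<close>

lemma tendsto_ceiling_right: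
  fixes u :: "nat \<Rightarrow> real"
  assumes "u \<longlonglongrightarrow> l" "\<And>j. u j > l"
  shows "(\<lambda>j. real_of_int \<lceil>u j\<rceil>) \<longlonglongrightarrow> of_int \<lfloor>l\<rfloor> + 1"
proof (rule tendsto_eventually)
  have "\<forall>\<^sub>F j in sequentially. u j < of_int \<lfloor>l\<rfloor> + 1"
    using assms(1) by (rule order_tendstoD) linarith
  then show "\<forall>\<^sub>F j in sequentially. real_of_int \<lceil>u j\<rceil> = of_int \<lfloor>l\<rfloor> + 1"
  proof eventually_elim
    case (elim j)
    have "\<lceil>u j\<rceil> = \<lfloor>l\<rfloor> + 1"
      by (rule ceiling_unique) (use elim assms(2)[of j] in \<open>simp_all, linarith\<close>)
    then show ?case by simp
  qed
qed

text \<open>The quantity \<open>M(\<alpha>,\<beta>)\<close> of the overview: the ceilings are the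
  partial sums of the upper mechanical word with intercept 0.\<close>

definition upper_val :: "real \<Rightarrow> real \<Rightarrow> real" where
  "upper_val \<beta> \<alpha> = wsum (1 / \<beta>) (\<lambda>n. of_int \<lceil>\<alpha> * real n\<rceil>)"

text \<open>The value of the lower mechanical word with intercept 0, which later turns out to be the
  minimum of the closure.\<close>

definition lower_val :: "real \<Rightarrow> real \<Rightarrow> real" where
  "lower_val \<beta> \<alpha> = wsum (1 / \<beta>) (\<lambda>n. of_int \<lfloor>\<alpha> * real n\<rfloor>)"

lemma lin_bounded_ceiling: "lin_bounded (\<lambda>n. of_int \<lceil>\<alpha> * real n\<rceil>)"
  by (rule lin_bounded_linear_dist[where a = \<alpha> and c = 1]) linarith

lemma lin_bounded_floor: "lin_bounded (\<lambda>n. of_int \<lfloor>\<alpha> * real n\<rfloor>)"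
  by (rule lin_bounded_linear_dist[where a = \<alpha> and c = 1]) linarith

lemma ratio_bounds:
  assumes "\<beta> > (1::real)"
  shows "0 < 1 / \<beta>" "0 \<le> 1 / \<beta>" "1 / \<beta> < 1"
  using assms by auto

text \<open>With \<open>a = \<alpha> * n\<close>, this bounds from below the sum of \<open>n\<close>
  consecutive letters of an upper mechanical word. Together with the next lemma it places every
  shift between the two extremal words.\<close>

lemma floor_le_ceiling_diff: "\<lfloor>a\<rfloor> \<le> \<lceil>a + b\<rceil> - \<lceil>b\<rceil>" for a b :: real
proof -
  have "\<lceil>b\<rceil> \<le> \<lceil>a + b\<rceil> - \<lfloor>a\<rfloor>" unfolding ceiling_le_iff of_int_diff by linarith
  then show ?thesis by simp
qed

lemma ceiling_diff_le: "\<lceil>a + b\<rceil> - \<lceil>b\<rceil> \<le> \<lceil>a\<rceil>" for a b :: real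
  using ceiling_add_le[of a b] by simp

lemma ceiling_le_floor_Suc: "\<lceil>a\<rceil> \<le> \<lfloor>a\<rfloor> + 1" for a :: real
  unfolding ceiling_le_iff of_int_add of_int_1 by linarith

text \<open>Ceilings exceed floors by at most 1, and agree at \<open>n = 0\<close>. The saving at
  index 0 matters: the constant 1 from index 1 onwards has weighted sum \<open>1 / \<beta>\<close>,
  the permitted length, instead of 1.\<close>

lemma upper_val_le_lower_val:
  assumes "\<beta> > 1"
  shows "upper_val \<beta> \<alpha> \<le> lower_val \<beta> \<alpha> + 1 / \<beta>"
proof -
  have "upper_val \<beta> \<alpha> \<le> wsum (1 / \<beta>) (\<lambda>n. of_int \<lfloor>\<alpha> * real n\<rfloor> + (if n = 0 then 0 else 1))"
    unfolding upper_val_def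
  proof (rule wsum_mono)
    fix n show "real_of_int \<lceil>\<alpha> * real n\<rceil> \<le> of_int \<lfloor>\<alpha> * real n\<rfloor> + (if n = 0 then 0 else 1)"
      by (cases "n = 0") (simp, use ceiling_le_floor_Suc[of "\<alpha> * real n"] in simp)
  qed (use assms in \<open>auto intro!: lin_bounded_ceiling lin_bounded_floor lin_bounded_if_pos\<close>)
  also have "\<dots> = lower_val \<beta> \<alpha> + 1 / \<beta>"
    unfolding lower_val_def using ratio_bounds[OF assms] wsum_if_pos[of "1 / \<beta>" 1]
    by (simp add: wsum_add lin_bounded_floor lin_bounded_if_pos)
  finally show ?thesis .
qed

text \<open>This supplies the distance from 0 that makes the map continuous on the closure. No floor
  is negative, and some floor is at least 1.\<close>

lemma lower_val_pos:
  assumes "\<beta> > 1" "\<alpha> > 0"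
  shows "lower_val \<beta> \<alpha> > 0"
proof -
  obtain m :: nat where m: "m > 0" "1 < real m * \<alpha>"
    using reals_Archimedean3[OF assms(2)] by (metis gr_zeroI mult_zero_left not_one_less_zero of_nat_0)
  have "wsum (1 / \<beta>) (\<lambda>n. 0) < lower_val \<beta> \<alpha>"
    unfolding lower_val_def
  proof (rule wsum_strict_mono)
    show "0 \<le> real_of_int \<lfloor>\<alpha> * real n\<rfloor>" for n using assms by simp
    show "0 < real_of_int \<lfloor>\<alpha> * real m\<rfloor>" using m by (simp add: mult.commute)
  qed (use assms in \<open>auto intro!: lin_bounded_floor\<close>)
  then show ?thesis using assms by (simp add: wsum_const)
qed

lemma upper_val_strict_mono:
  assumes "\<beta> > 1" "\<alpha> < \<alpha>'"
  shows "upper_val \<beta> \<alpha> < upper_val \<beta> \<alpha>'"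
proof -
  \<comment> \<open>At this index the two products differ by more than 1, so their ceilings
    differ.\<close>
  obtain m :: nat where m: "1 < real m * (\<alpha>' - \<alpha>)"
    using reals_Archimedean3[of "\<alpha>' - \<alpha>"] assms by auto
  show ?thesis unfolding upper_val_def
  proof (rule wsum_strict_mono)
    show "real_of_int \<lceil>\<alpha> * real n\<rceil> \<le> real_of_int \<lceil>\<alpha>' * real n\<rceil>" for n
      using assms by (auto intro!: ceiling_mono mult_right_mono)
    show "real_of_int \<lceil>\<alpha> * real m\<rceil> < real_of_int \<lceil>\<alpha>' * real m\<rceil>"
    proof -
      have "\<alpha> * real m + 1 < \<alpha>' * real m" using m by (simp add: algebra_simps)
      then show ?thesis by linarith
    qed
  qed (use assms in \<open>auto intro!: lin_bounded_ceiling\<close>)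
qed

text \<open>The value of the \<open>k\<close>-th shift of the upper mechanical word, via the partial
  sums of the shifted word.\<close>

definition upper_pt :: "real \<Rightarrow> real \<Rightarrow> nat \<Rightarrow> real" where
  "upper_pt \<beta> \<alpha> k = wsum (1 / \<beta>) (\<lambda>n. of_int (\<lceil>\<alpha> * real (n + k)\<rceil> - \<lceil>\<alpha> * real k\<rceil>))"

lemma upper_pt_0: "upper_pt \<beta> \<alpha> 0 = upper_val \<beta> \<alpha>"
  by (simp add: upper_pt_def upper_val_def)

lemma lin_bounded_upper_pt:
  "lin_bounded (\<lambda>n. of_int (\<lceil>\<alpha> * real (n + k)\<rceil> - \<lceil>\<alpha> * real k\<rceil>))"
  by (rule lin_bounded_linear_dist[where a = \<alpha> and c = 1]) (simp add: distrib_left, linarith)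

lemma upper_pt_le:
  assumes "\<beta> > 1"
  shows "upper_pt \<beta> \<alpha> k \<le> upper_val \<beta> \<alpha>"
  unfolding upper_pt_def upper_val_def
  by (intro wsum_mono lin_bounded_upper_pt lin_bounded_ceiling ratio_bounds assms)
    (simp only: of_nat_add distrib_left of_int_le_iff ceiling_diff_le)

lemma upper_pt_ge:
  assumes "\<beta> > 1"
  shows "lower_val \<beta> \<alpha> \<le> upper_pt \<beta> \<alpha> k"
  unfolding upper_pt_def lower_val_def
  by (intro wsum_mono lin_bounded_upper_pt lin_bounded_floor ratio_bounds assms)
    (simp only: of_nat_add distrib_left of_int_le_iff floor_le_ceiling_diff)

lemma upper_pt_Suc:
  assumes "\<beta> > 1"
  shows "upper_pt \<beta> \<alpha> (Suc k) = \<beta> * upper_pt \<beta> \<alpha> k - of_int (\<lceil>\<alpha> * real (Suc k)\<rceil> - \<lceil>\<alpha> * real k\<rceil>)"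
proof -
  let ?d = "real_of_int (\<lceil>\<alpha> * real (Suc k)\<rceil> - \<lceil>\<alpha> * real k\<rceil>)"
  have "\<beta> * upper_pt \<beta> \<alpha> k = wsum (1 / \<beta>) (\<lambda>n. of_int (\<lceil>\<alpha> * real (Suc n + k)\<rceil> - \<lceil>\<alpha> * real k\<rceil>))"
    using wsum_shift[OF lin_bounded_upper_pt ratio_bounds(2,3)[OF assms], of \<alpha> k] assms
    by (simp add: upper_pt_def)
  also have "\<dots> = wsum (1 / \<beta>) (\<lambda>n. of_int (\<lceil>\<alpha> * real (n + Suc k)\<rceil> - \<lceil>\<alpha> * real (Suc k)\<rceil>) + ?d)"
    by (intro arg_cong2[where f = wsum] ext) auto
  also have "\<dots> = upper_pt \<beta> \<alpha> (Suc k) + ?d"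
    unfolding upper_pt_def
    by (simp only: wsum_add[OF lin_bounded_upper_pt lin_bounded_const ratio_bounds(2,3)[OF assms]]
        wsum_const[OF ratio_bounds(2,3)[OF assms]])
  finally show ?thesis by simp
qed

context
  fixes \<beta> \<alpha> :: real
  assumes \<beta>: "\<beta> > 1" and \<alpha>: "\<alpha> > 0" and le1: "upper_val \<beta> \<alpha> \<le> 1"
begin

text \<open>Deleting the leading letter multiplies the value by \<open>\<beta>\<close> and subtracts
  that letter. This is a step of the map because the result lies in (0,1]: it is at least
  \<open>lower_val\<close>, which is positive, and at most \<open>upper_val\<close>.\<close>

lemma funpow_Tbar_upper_val: "(Tbar \<beta> ^^ k) (upper_val \<beta> \<alpha>) = upper_pt \<beta> \<alpha> k"
proof (induction k)
  case (Suc k)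
  have "0 < upper_pt \<beta> \<alpha> (Suc k)" "upper_pt \<beta> \<alpha> (Suc k) \<le> 1"
    using upper_pt_ge[OF \<beta>, of \<alpha> "Suc k"] lower_val_pos[OF \<beta> \<alpha>] upper_pt_le[OF \<beta>, of \<alpha> "Suc k"] le1
    by linarith+
  then have "Tbar \<beta> (upper_pt \<beta> \<alpha> k) = upper_pt \<beta> \<alpha> (Suc k)"
    using upper_pt_Suc[OF \<beta>] Tbar_eqI by metis
  then show ?case using Suc by simp
qed (simp add: upper_pt_0)

lemma dbar_upper_val: "dbar \<beta> (upper_val \<beta> \<alpha>) = mech_upper \<alpha> 0"
proof
  fix k
  have "real_of_int (dbar \<beta> (upper_val \<beta> \<alpha>) k) = of_int (\<lceil>\<alpha> * real (Suc k)\<rceil> - \<lceil>\<alpha> * real k\<rceil>)"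
    unfolding dbar_eq funpow_Tbar_upper_val using upper_pt_Suc[OF \<beta>, of \<alpha> k] by simp
  then have "dbar \<beta> (upper_val \<beta> \<alpha>) k = \<lceil>\<alpha> * real (Suc k)\<rceil> - \<lceil>\<alpha> * real k\<rceil>"
    by (simp only: of_int_eq_iff)
  then show "dbar \<beta> (upper_val \<beta> \<alpha>) k = mech_upper \<alpha> 0 k"
    by (simp add: mech_upper_def add.commute)
qed

end

section \<open>Recurrence of the mechanical word and invariance of its closure\<close>

lemma dsum_of_dbar_mech_upper:
  assumes "dbar \<beta> x = mech_upper \<alpha> 0"
  shows "dsum \<beta> x n = of_int \<lceil>\<alpha> * real n\<rceil>"
  by (induction n) (simp_all add: dsum_Suc assms mech_upper_def add.commute)

text \<open>For a rational slope a multiple of the denominator hits an integer exactly. For an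
  irrational slope Kronecker's theorem brings the fractional part close to 1, that is, approaches an
  integer from below.\<close>

lemma ceiling_dist_small:
  fixes \<alpha> e :: real
  assumes "e > 0"
  obtains k :: nat where "k > 0" "of_int \<lceil>\<alpha> * real k\<rceil> - \<alpha> * real k < e"
proof (cases "\<alpha> \<in> \<rat>")
  case True
  then obtain a b where ab: "\<alpha> = of_int a / of_int b" "b > (0::int)" by (meson Rats_cases')
  have "\<alpha> * real (nat b) = of_int a" using ab by simp
  then show ?thesis using that[of "nat b"] ab assms by simp
next
  case False
  then obtain k :: nat where k: "k > 0" "\<bar>frac (real k * \<alpha>) - 1\<bar> < e"
    using Kronecker_approx_1_explicit[of \<alpha> 1 e] assms by auto
  moreover have "of_int \<lceil>\<alpha> * real k\<rceil> - \<alpha> * real k \<le> 1 - frac (real k * \<alpha>)"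
    unfolding frac_def mult.commute[of "real k"] using ceiling_le_floor_Suc[of "\<alpha> * real k"] by linarith
  ultimately show ?thesis using that[of k] by linarith
qed

text \<open>A shift by \<open>k\<close> with \<open>\<alpha> * k\<close> slightly below an integer,
  at distance \<delta>, turns the partial sums into the ceilings of
  \<open>\<alpha> * n - \<delta>\<close>. These converge because the ceiling is left-continuous. The
  index \<open>Suc k\<close> makes the return time positive, so the nearby point is an image under
  the map.\<close>

lemma upper_pt_recurrent:
  assumes "\<beta> > 1" "r > 0"
  obtains k where "\<bar>upper_pt \<beta> \<alpha> (Suc k) - upper_val \<beta> \<alpha>\<bar> < r"
proof -
  have "\<exists>k::nat. of_int \<lceil>\<alpha> * real (Suc k)\<rceil> - \<alpha> * real (Suc k) < 1 / real (Suc j)" for j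
  proof -
    obtain k :: nat where "k > 0" "of_int \<lceil>\<alpha> * real k\<rceil> - \<alpha> * real k < 1 / real (Suc j)"
      using ceiling_dist_small[of "1 / real (Suc j)" \<alpha>] by auto
    then show ?thesis by (intro exI[of _ "k - 1"]) simp
  qed
  then obtain k where k: "\<And>j. of_int \<lceil>\<alpha> * real (Suc (k j))\<rceil> - \<alpha> * real (Suc (k j)) < 1 / real (Suc j)"
    by metis
  define \<delta> where "\<delta> j = of_int \<lceil>\<alpha> * real (Suc (k j))\<rceil> - \<alpha> * real (Suc (k j))" for j
  have \<delta>0: "\<delta> j \<ge> 0" and \<delta>1: "\<delta> j < 1 / real (Suc j)" for j
    unfolding \<delta>_def using k[of j] by (linarith, simp)
  have \<delta>: "\<delta> \<longlonglongrightarrow> 0"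
  proof (rule tendsto_sandwich)
    show "\<forall>\<^sub>F j in sequentially. 0 \<le> \<delta> j" using \<delta>0 by simp
    show "\<forall>\<^sub>F j in sequentially. \<delta> j \<le> 1 / real (Suc j)"
      using \<delta>1 less_imp_le by (intro always_eventually) blast
    show "(\<lambda>j. 1 / real (Suc j)) \<longlonglongrightarrow> 0" using LIMSEQ_Suc[OF lim_const_over_n[of 1]] by simp
  qed (rule tendsto_const)
  have eq: "upper_pt \<beta> \<alpha> (Suc (k j)) = wsum (1 / \<beta>) (\<lambda>n. of_int \<lceil>\<alpha> * real n - \<delta> j\<rceil>)" for j
    unfolding upper_pt_def
  proof (intro arg_cong2[where f = wsum] ext refl arg_cong[where f = real_of_int])
    fix n
    have "\<alpha> * real (n + Suc (k j)) = (\<alpha> * real n - \<delta> j) + of_int \<lceil>\<alpha> * real (Suc (k j))\<rceil>"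
      unfolding \<delta>_def by (simp add: algebra_simps)
    then show "\<lceil>\<alpha> * real (n + Suc (k j))\<rceil> - \<lceil>\<alpha> * real (Suc (k j))\<rceil> = \<lceil>\<alpha> * real n - \<delta> j\<rceil>"
      by (metis add_diff_cancel_right' ceiling_add_of_int)
  qed
  have "(\<lambda>j. upper_pt \<beta> \<alpha> (Suc (k j))) \<longlonglongrightarrow> upper_val \<beta> \<alpha>"
    unfolding upper_val_def eq
  proof (rule wsum_tendsto[where C = "\<bar>\<alpha>\<bar> + 2"])
    show "(\<lambda>j. real_of_int \<lceil>\<alpha> * real n - \<delta> j\<rceil>) \<longlonglongrightarrow> of_int \<lceil>\<alpha> * real n\<rceil>" for n
    proof (rule tendsto_ceiling_left)
      show "(\<lambda>j. \<alpha> * real n - \<delta> j) \<longlonglongrightarrow> \<alpha> * real n"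
        using tendsto_diff[OF tendsto_const \<delta>, of "\<alpha> * real n"] by simp
    qed (use \<delta>0 in simp)
    show "\<bar>real_of_int \<lceil>\<alpha> * real n - \<delta> j\<rceil>\<bar> \<le> (\<bar>\<alpha>\<bar> + 2) * (real n + 1)" for j n
    proof -
      have "1 / real (Suc j) \<le> 1" by simp
      then have "\<delta> j < 1" using \<delta>1[of j] by linarith
      then have "\<bar>real_of_int \<lceil>\<alpha> * real n - \<delta> j\<rceil>\<bar> \<le> \<bar>\<alpha> * real n\<bar> + 2" using \<delta>0[of j] by linarith
      also have "\<dots> \<le> (\<bar>\<alpha>\<bar> + 2) * (real n + 1)" by (simp add: algebra_simps abs_mult)
      finally show ?thesis .
    qed
  qed (use assms in auto)
  then have "\<forall>\<^sub>F j in sequentially. dist (upper_pt \<beta> \<alpha> (Suc (k j))) (upper_val \<beta> \<alpha>) < r"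
    using assms(2) by (rule tendstoD)
  then obtain j where "dist (upper_pt \<beta> \<alpha> (Suc (k j))) (upper_val \<beta> \<alpha>) < r"
    by (meson eventually_sequentially order_refl)
  then show ?thesis using that by (auto simp: dist_real_def)
qed

lemma mechanical_closure:
  fixes \<beta> \<alpha> :: real
  assumes \<beta>: "\<beta> > 1" and \<alpha>: "\<alpha> > 0" and le1: "upper_val \<beta> \<alpha> \<le> 1"
  defines "S \<equiv> closure (orbit \<beta> (upper_val \<beta> \<alpha>))"
  shows "invariant_orbit_closure \<beta> S" "S \<subseteq> {lower_val \<beta> \<alpha>..upper_val \<beta> \<alpha>}" "set_has_frequency \<beta> S \<alpha>"
proof -
  let ?x = "upper_val \<beta> \<alpha>" and ?e = "lower_val \<beta> \<alpha>"
  have e: "?e > 0" by (rule lower_val_pos[OF \<beta> \<alpha>])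
  have orb: "orbit \<beta> ?x = range (upper_pt \<beta> \<alpha>)"
    unfolding orbit_def funpow_Tbar_upper_val[OF assms(1-3)] ..
  have x01: "?x \<in> {0..1}"
    using upper_pt_ge[OF \<beta>, of \<alpha> 0] e le1 by (auto simp: upper_pt_0)
  show sub: "S \<subseteq> {?e..?x}"
    unfolding S_def orb using upper_pt_le[OF \<beta>] upper_pt_ge[OF \<beta>] by (intro closure_minimal) auto
  then have sub': "S \<subseteq> {?e..}" by auto
  have inv: "Tbar \<beta> ` S \<subseteq> S"
    unfolding S_def by (rule Tbar_closure[OF \<beta> Tbar_orbit sub'[unfolded S_def] e])
  \<comment> \<open>The starting point is the only orbit point without an evident preimage;
    recurrence makes it a limit of images.\<close>
  have a1: "?x \<in> closure (Tbar \<beta> ` orbit \<beta> ?x)"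
    unfolding closure_approachable
  proof (intro allI impI)
    fix r :: real assume "r > 0"
    then obtain k where k: "\<bar>upper_pt \<beta> \<alpha> (Suc k) - ?x\<bar> < r" by (rule upper_pt_recurrent[OF \<beta>])
    have "upper_pt \<beta> \<alpha> (Suc k) = Tbar \<beta> (upper_pt \<beta> \<alpha> k)"
      using funpow_Tbar_upper_val[OF assms(1-3), of "Suc k"]
        funpow_Tbar_upper_val[OF assms(1-3), of k] by simp
    moreover have "Tbar \<beta> (upper_pt \<beta> \<alpha> k) \<in> Tbar \<beta> ` orbit \<beta> ?x"
      unfolding orb by (intro imageI rangeI)
    ultimately have "upper_pt \<beta> \<alpha> (Suc k) \<in> Tbar \<beta> ` orbit \<beta> ?x" by simp
    then show "\<exists>y\<in>Tbar \<beta> ` orbit \<beta> ?x. dist y ?x < r"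
      by (rule bexI[rotated]) (use k in \<open>simp add: dist_real_def\<close>)
  qed
  \<comment> \<open>The image of the compact set \<open>S\<close> under a map continuous on it is
    closed, so limits of images are again images.\<close>
  have a2: "closure (Tbar \<beta> ` orbit \<beta> ?x) \<subseteq> Tbar \<beta> ` S"
  proof (rule closure_minimal)
    show "Tbar \<beta> ` orbit \<beta> ?x \<subseteq> Tbar \<beta> ` S" unfolding S_def by (intro image_mono closure_subset)
    have "compact S"
      unfolding compact_eq_bounded_closed
      using bounded_subset[OF bounded_closed_interval sub] by (simp add: S_def)
    then show "closed (Tbar \<beta> ` S)"
      using continuous_on_Tbar[OF \<beta> inv sub' e] by (intro compact_imp_closed compact_continuous_image)
  qed
  have sup: "closure (orbit \<beta> ?x) \<subseteq> Tbar \<beta> ` S"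
  proof -
    have "orbit \<beta> ?x \<subseteq> closure (Tbar \<beta> ` orbit \<beta> ?x)"
    proof
      fix y assume "y \<in> orbit \<beta> ?x"
      then obtain n where n: "y = (Tbar \<beta> ^^ n) ?x" by (auto simp: orbit_def)
      show "y \<in> closure (Tbar \<beta> ` orbit \<beta> ?x)"
      proof (cases n)
        case (Suc m)
        then have "y \<in> Tbar \<beta> ` orbit \<beta> ?x" using n by (auto simp: orbit_def)
        then show ?thesis by (rule closure_subset[THEN subsetD])
      qed (use a1 n in simp)
    qed
    then have "closure (orbit \<beta> ?x) \<subseteq> closure (Tbar \<beta> ` orbit \<beta> ?x)"
      by (rule closure_minimal) simp
    then show ?thesis using a2 by (rule order_trans)
  qed
  show "invariant_orbit_closure \<beta> S"
    unfolding invariant_orbit_closure_def orbit_closure_iff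
  proof
    show "\<exists>x\<in>{0..1}. S = closure (orbit \<beta> x)" unfolding S_def by (intro bexI[of _ ?x] refl x01)
    show "Tbar \<beta> ` S = S" using inv sup unfolding S_def by (rule equalityI)
  qed
  show "set_has_frequency \<beta> S \<alpha>"
    unfolding set_has_frequency_def
  proof (intro ballI point_has_frequencyI)
    fix y n assume y: "y \<in> S"
    have cont: "continuous_on S (\<lambda>y. dsum \<beta> y n - \<alpha> * real n)"
      by (intro continuous_intros continuous_on_dsum[OF \<beta> inv sub' e])
    \<comment> \<open>Digit sums of orbit points are differences of two ceilings. The bound passes
      to the closure by continuity.\<close>
    have bd: "\<bar>dsum \<beta> u n - \<alpha> * real n\<bar> \<le> 1" if "u \<in> orbit \<beta> ?x" for u
    proof -
      obtain k where u: "u = (Tbar \<beta> ^^ k) ?x" using \<open>u \<in> orbit \<beta> ?x\<close> by (auto simp: orbit_def)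
      have "dsum \<beta> ?x (k + n) = dsum \<beta> ?x k + dsum \<beta> u n" unfolding u by (rule dsum_add)
      then have "dsum \<beta> u n = of_int \<lceil>\<alpha> * real k + \<alpha> * real n\<rceil> - of_int \<lceil>\<alpha> * real k\<rceil>"
        by (simp add: dsum_of_dbar_mech_upper[OF dbar_upper_val[OF assms(1-3)]] distrib_left)
      then show ?thesis by linarith
    qed
    have "norm (dsum \<beta> y n - \<alpha> * real n) \<le> 1"
      by (rule continuous_on_closure_norm_le[OF cont[unfolded S_def] _ y[unfolded S_def]])
        (use bd in simp)
    then show "\<bar>dsum \<beta> y n - \<alpha> * real n\<bar> \<le> 1" by simp
  qed
qed

section \<open>Characterisation of well-definedness\<close>

text \<open>Subadditivity gives digit sums of at least \<open>\<alpha> * n\<close>, and integrality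
  improves this to the ceiling. It is phrased for a set with a greatest element, so that it serves
  both closures and the orbit of 1.\<close>

lemma upper_val_le_max:
  assumes \<beta>: "\<beta> > 1" and S: "short \<beta> S" "Tbar \<beta> ` S \<subseteq> S"
    and m: "m \<in> S" "\<And>x. x \<in> S \<Longrightarrow> x \<le> m" and freq: "point_has_frequency \<beta> m \<alpha>" and m01: "m \<in> {0..1}"
  shows "upper_val \<beta> \<alpha> \<le> m"
proof -
  have "upper_val \<beta> \<alpha> \<le> wsum (1 / \<beta>) (dsum \<beta> m)"
    unfolding upper_val_def
  proof (rule wsum_mono[OF lin_bounded_ceiling lin_bounded_dsum[OF \<beta> m01] ratio_bounds(2,3)[OF \<beta>]])
    fix n
    obtain k where k: "dsum \<beta> m n = of_int k" using dsum_Ints[of \<beta> m n] by (elim Ints_cases)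
    have "\<alpha> * real n \<le> dsum \<beta> m n" by (rule dsum_max_ge[OF \<beta> S m freq])
    then show "real_of_int \<lceil>\<alpha> * real n\<rceil> \<le> dsum \<beta> m n" unfolding k by (simp add: ceiling_le_iff)
  qed
  then show ?thesis unfolding wsum_dsum[OF \<beta> m01] .
qed

lemma Xi_well_defined_iff:
  assumes \<beta>: "\<beta> > 1" and \<alpha>: "\<alpha> > 0"
  shows "Xi_well_defined \<alpha> \<beta> \<longleftrightarrow> upper_val \<beta> \<alpha> \<le> 1"
proof
  assume "Xi_well_defined \<alpha> \<beta>"
  then obtain S t x where S: "Tbar \<beta> ` S = S" "S = closure (orbit \<beta> x)"
    and t: "{t..t + 1 / \<beta>} \<subseteq> {0..1}" "S \<subseteq> {t..t + 1 / \<beta>}" and freq: "set_has_frequency \<beta> S \<alpha>"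
    unfolding Xi_well_defined_def Xi_closure_def invariant_orbit_closure_def orbit_closure_iff by blast
  have "bounded S" using t(2) by (rule bounded_subset[OF bounded_closed_interval])
  then have "compact S" unfolding compact_eq_bounded_closed using S(2) by simp
  moreover have "x \<in> S"
    unfolding S(2) by (rule closure_subset[THEN subsetD]) (auto simp: orbit_def intro: range_eqI[of _ _ 0])
  ultimately obtain m where m: "m \<in> S" "\<And>y. y \<in> S \<Longrightarrow> y \<le> m"
    using compact_attains_sup[of S] by blast
  have m01: "m \<in> {0..1}" using m(1) t by blast
  have "upper_val \<beta> \<alpha> \<le> m"
    by (rule upper_val_le_max[OF \<beta> short_subset_interval[OF t(2)] equalityD1[OF S(1)] m _ m01])
      (use freq m(1) in \<open>simp_all add: set_has_frequency_def\<close>)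
  then show "upper_val \<beta> \<alpha> \<le> 1" using m01 by simp
next
  assume le1: "upper_val \<beta> \<alpha> \<le> 1"
  let ?S = "closure (orbit \<beta> (upper_val \<beta> \<alpha>))"
  \<comment> \<open>The interval ends at \<open>upper_val\<close> unless its left end would then be
    negative, in which case it starts at 0.\<close>
  define t where "t = max 0 (upper_val \<beta> \<alpha> - 1 / \<beta>)"
  have t: "0 \<le> t" "t + 1 / \<beta> \<le> 1" "upper_val \<beta> \<alpha> \<le> t + 1 / \<beta>"
    using ratio_bounds[OF \<beta>] le1 unfolding t_def by linarith+
  have "t \<le> lower_val \<beta> \<alpha>"
    using upper_val_le_lower_val[OF \<beta>, of \<alpha>] lower_val_pos[OF \<beta> \<alpha>] by (auto simp: t_def)
  then have "{lower_val \<beta> \<alpha>..upper_val \<beta> \<alpha>} \<subseteq> {t..t + 1 / \<beta>}" using t by auto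
  then have "?S \<subseteq> {t..t + 1 / \<beta>}"
    using mechanical_closure(2)[OF \<beta> \<alpha> le1] by (rule order_trans[rotated])
  moreover have "{t..t + 1 / \<beta>} \<subseteq> {0..1}" using t by auto
  ultimately show "Xi_well_defined \<alpha> \<beta>"
    unfolding Xi_well_defined_def Xi_closure_def
    using mechanical_closure(1,3)[OF \<beta> \<alpha> le1] by blast
qed

section \<open>Dependence on the base and the function \<open>Delta\<close>\<close>

lemma upper_val_antimono:
  assumes "\<alpha> > 0" "1 < \<beta>" "\<beta> < \<beta>'"
  shows "upper_val \<beta>' \<alpha> < upper_val \<beta> \<alpha>"
  unfolding upper_val_def
proof (rule wsum_strict_mono_ratio[OF lin_bounded_ceiling])
  show "mono (\<lambda>n. real_of_int \<lceil>\<alpha> * real n\<rceil>)"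
    using assms(1) by (intro monoI) (simp add: ceiling_mono)
  show "1 / \<beta>' < 1 / \<beta>" using assms by (intro divide_strict_left_mono) auto
qed (use assms in auto)

lemma upper_val_eq_1_unique:
  assumes "\<alpha> > 0"
  shows "\<exists>!\<beta>. \<beta> > 1 \<and> upper_val \<beta> \<alpha> = 1"
proof (rule ex_ex1I)
  let ?A = "\<lambda>n. real_of_int \<lceil>\<alpha> * real n\<rceil>"
  \<comment> \<open>At this ratio the sequence \<open>\<alpha> * n\<close> has weighted sum exactly
    1, so its ceilings have at least 1; at ratio 0 the value is 0. The intermediate value theorem
    applies between them.\<close>
  let ?z = "1 / (1 + \<alpha>)"
  have z: "0 < ?z" "?z < 1" using assms by auto
  have "wsum ?z (\<lambda>n. \<alpha> * real n) \<le> wsum ?z ?A"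
    by (rule wsum_mono[OF lin_bounded_linear lin_bounded_ceiling]) (use z in auto)
  moreover have "wsum ?z (\<lambda>n. \<alpha> * real n) = 1"
    using wsum_linear[of ?z \<alpha>] z assms by (simp add: field_simps)
  ultimately have "1 \<le> wsum ?z ?A" by simp
  moreover have "wsum 0 ?A \<le> 1"
    using wsum_shift[OF lin_bounded_ceiling, of 0 \<alpha>] by simp
  moreover have "\<forall>x. 0 \<le> x \<and> x \<le> ?z \<longrightarrow> isCont (\<lambda>z. wsum z ?A) x"
    using isCont_wsum[OF lin_bounded_ceiling] z(2) by (meson le_less_trans)
  ultimately obtain w where w: "0 \<le> w" "w \<le> ?z" "wsum w ?A = 1"
    using IVT[of "\<lambda>z. wsum z ?A" 0 1 ?z] z by auto
  have "w \<noteq> 0" using w wsum_shift[OF lin_bounded_ceiling, of 0 \<alpha>] by auto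
  then have "1 / w > 1" using w(1) le_less_trans[OF w(2) z(2)] by simp
  moreover have "upper_val (1 / w) \<alpha> = 1" using w by (simp add: upper_val_def)
  ultimately show "\<exists>\<beta>. \<beta> > 1 \<and> upper_val \<beta> \<alpha> = 1" by blast
next
  fix \<beta> \<beta>' assume *: "\<beta> > 1 \<and> upper_val \<beta> \<alpha> = 1" "\<beta>' > 1 \<and> upper_val \<beta>' \<alpha> = 1"
  show "\<beta> = \<beta>'"
    using * upper_val_antimono[OF assms, of \<beta> \<beta>'] upper_val_antimono[OF assms, of \<beta>' \<beta>]
    by (cases \<beta> \<beta>' rule: linorder_cases) auto
qed

text \<open>Forwards, 1 is the value of its expansion. Backwards, this is the boundary case of the
  orbit already computed for \<open>upper_val\<close>.\<close>

lemma dbar_1_mech_upper_iff: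
  assumes "\<beta> > 1" "\<alpha> > 0"
  shows "dbar \<beta> 1 = mech_upper \<alpha> 0 \<longleftrightarrow> upper_val \<beta> \<alpha> = 1"
proof
  assume "dbar \<beta> 1 = mech_upper \<alpha> 0"
  then have "dsum \<beta> 1 = (\<lambda>n. of_int \<lceil>\<alpha> * real n\<rceil>)"
    using dsum_of_dbar_mech_upper by (intro ext) blast
  then show "upper_val \<beta> \<alpha> = 1" using wsum_dsum[OF assms(1), of 1] by (simp add: upper_val_def)
next
  assume "upper_val \<beta> \<alpha> = 1"
  then show "dbar \<beta> 1 = mech_upper \<alpha> 0" using dbar_upper_val[OF assms] by simp
qed

lemma Delta_props:
  assumes "\<alpha> > 0"
  shows "Delta \<alpha> > 1" "upper_val (Delta \<alpha>) \<alpha> = 1"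
proof -
  have "(\<lambda>\<beta>. \<beta> > 1 \<and> dbar \<beta> 1 = mech_upper \<alpha> 0) = (\<lambda>\<beta>. \<beta> > 1 \<and> upper_val \<beta> \<alpha> = 1)"
    using dbar_1_mech_upper_iff[OF _ assms] by (intro ext) blast
  then have "Delta \<alpha> = (THE \<beta>. \<beta> > 1 \<and> upper_val \<beta> \<alpha> = 1)" by (simp add: Delta_def)
  then show "Delta \<alpha> > 1" "upper_val (Delta \<alpha>) \<alpha> = 1"
    using theI'[OF upper_val_eq_1_unique[OF assms]] by auto
qed

lemma upper_val_le_1_iff_Delta:
  assumes "\<alpha> > 0" "\<beta> > 1"
  shows "upper_val \<beta> \<alpha> \<le> 1 \<longleftrightarrow> Delta \<alpha> \<le> \<beta>"
  using upper_val_antimono[OF assms(1), of \<beta> "Delta \<alpha>"] upper_val_antimono[OF assms(1), of "Delta \<alpha>" \<beta>]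
    Delta_props[OF assms(1)] assms(2)
  by (cases \<beta> "Delta \<alpha>" rule: linorder_cases) auto

section \<open>Mechanical expansions of 1\<close>

lemma mechanical_dsum:
  assumes "mechanical_word \<alpha> (dbar \<beta> x)"
  obtains \<rho> where "dsum \<beta> x = (\<lambda>n. of_int (\<lfloor>\<alpha> * real n + \<rho>\<rfloor> - \<lfloor>\<rho>\<rfloor>)) \<or>
    dsum \<beta> x = (\<lambda>n. of_int (\<lceil>\<alpha> * real n + \<rho>\<rceil> - \<lceil>\<rho>\<rceil>))"
proof -
  obtain \<rho> where \<rho>: "dbar \<beta> x = mech_lower \<alpha> \<rho> \<or> dbar \<beta> x = mech_upper \<alpha> \<rho>"
    using assms by (auto simp: mechanical_word_def)
  have "dsum \<beta> x n = of_int (\<lfloor>\<alpha> * real n + \<rho>\<rfloor> - \<lfloor>\<rho>\<rfloor>)" if "dbar \<beta> x = mech_lower \<alpha> \<rho>" for n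
    by (induction n) (simp_all add: dsum_Suc that mech_lower_def add.commute)
  moreover have "dsum \<beta> x n = of_int (\<lceil>\<alpha> * real n + \<rho>\<rceil> - \<lceil>\<rho>\<rceil>)" if "dbar \<beta> x = mech_upper \<alpha> \<rho>" for n
    by (induction n) (simp_all add: dsum_Suc that mech_upper_def add.commute)
  ultimately show ?thesis using \<rho> by (intro that[of \<rho>]) (auto intro!: ext)
qed

lemma floor_diff_bounds: "\<lfloor>a\<rfloor> \<le> \<lfloor>b + a\<rfloor> - \<lfloor>b\<rfloor>" "\<lfloor>b + a\<rfloor> - \<lfloor>b\<rfloor> \<le> \<lceil>a\<rceil>" for a b :: real
  using le_floor_add[of b a] by (simp, linarith)

text \<open>The digit sums of all points in the orbit of \<open>1\<close> are squeezed between \<open>\<lfloor>\<alpha> n\<rfloor>\<close> and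
  \<open>\<lceil>\<alpha> n\<rceil>\<close>, so the orbit lies in \<open>[1 - 1/\<beta>, 1]\<close> and its maximum is \<open>1\<close>.\<close>

lemma mechanical_imp_upper_val_le_1:
  assumes \<beta>: "\<beta> > 1" and mech: "mechanical_word \<alpha> (dbar \<beta> 1)"
  shows "upper_val \<beta> \<alpha> \<le> 1"
proof -
  obtain \<rho> where \<rho>: "dsum \<beta> 1 = (\<lambda>n. of_int (\<lfloor>\<alpha> * real n + \<rho>\<rfloor> - \<lfloor>\<rho>\<rfloor>)) \<or>
    dsum \<beta> 1 = (\<lambda>n. of_int (\<lceil>\<alpha> * real n + \<rho>\<rceil> - \<lceil>\<rho>\<rceil>))"
    using mechanical_dsum[OF mech] by blast
  have orb01: "y \<in> {0..1}" if "y \<in> orbit \<beta> 1" for y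
    using that funpow_Tbar_bounds[of 1] by (auto simp: orbit_def)
  have bd: "of_int \<lfloor>\<alpha> * real n\<rfloor> \<le> dsum \<beta> y n \<and> dsum \<beta> y n \<le> of_int \<lceil>\<alpha> * real n\<rceil>"
    if "y \<in> orbit \<beta> 1" for y n
  proof -
    obtain k where y: "y = (Tbar \<beta> ^^ k) 1" using \<open>y \<in> orbit \<beta> 1\<close> by (auto simp: orbit_def)
    \<comment> \<open>Digit sums along the orbit are sums over windows of the expansion of
      1.\<close>
    have eq: "dsum \<beta> y n = dsum \<beta> 1 (k + n) - dsum \<beta> 1 k" by (simp add: dsum_add y)
    from \<rho> show ?thesis
    proof
      assume *: "dsum \<beta> 1 = (\<lambda>n. of_int (\<lfloor>\<alpha> * real n + \<rho>\<rfloor> - \<lfloor>\<rho>\<rfloor>))"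
      define b where "b = \<alpha> * real k + \<rho>"
      have "\<alpha> * real (k + n) + \<rho> = b + \<alpha> * real n" by (simp add: b_def algebra_simps)
      then have "dsum \<beta> y n = of_int (\<lfloor>b + \<alpha> * real n\<rfloor> - \<lfloor>b\<rfloor>)"
        unfolding eq * b_def[symmetric] by simp
      then show ?thesis using floor_diff_bounds[where a = "\<alpha> * real n" and b = b] by (simp only: of_int_le_iff)
    next
      assume *: "dsum \<beta> 1 = (\<lambda>n. of_int (\<lceil>\<alpha> * real n + \<rho>\<rceil> - \<lceil>\<rho>\<rceil>))"
      define b where "b = \<alpha> * real k + \<rho>"
      have "\<alpha> * real (k + n) + \<rho> = \<alpha> * real n + b" by (simp add: b_def algebra_simps)
      then have "dsum \<beta> y n = of_int (\<lceil>\<alpha> * real n + b\<rceil> - \<lceil>b\<rceil>)"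
        unfolding eq * b_def[symmetric] by simp
      then show ?thesis using floor_le_ceiling_diff[of "\<alpha> * real n" b] ceiling_diff_le[of "\<alpha> * real n" b]
        by (simp only: of_int_le_iff)
    qed
  qed
  have "lower_val \<beta> \<alpha> \<le> y" "y \<le> upper_val \<beta> \<alpha>" if "y \<in> orbit \<beta> 1" for y
  proof -
    have "lower_val \<beta> \<alpha> \<le> wsum (1 / \<beta>) (dsum \<beta> y)" "wsum (1 / \<beta>) (dsum \<beta> y) \<le> upper_val \<beta> \<alpha>"
      unfolding lower_val_def upper_val_def
      by (rule wsum_mono; use \<beta> bd that orb01[OF that] in
          \<open>auto intro!: lin_bounded_floor lin_bounded_ceiling lin_bounded_dsum\<close>)+
    then show "lower_val \<beta> \<alpha> \<le> y" "y \<le> upper_val \<beta> \<alpha>" using wsum_dsum[OF \<beta> orb01[OF that]] by simp_all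
  qed
  then have short: "short \<beta> (orbit \<beta> 1)"
    using upper_val_le_lower_val[OF \<beta>, of \<alpha>]
    by (intro short_subset_interval[of _ "lower_val \<beta> \<alpha>"]) fastforce
  have mem: "1 \<in> orbit \<beta> 1" by (auto simp: orbit_def intro: range_eqI[of _ _ 0])
  have freq: "point_has_frequency \<beta> 1 \<alpha>"
  proof (rule point_has_frequencyI[where c = 1])
    fix n
    have "\<bar>dsum \<beta> 1 n - \<alpha> * real n\<bar> \<le> 1" using bd[OF mem, of n] by linarith
    then show "\<bar>dsum \<beta> 1 n - \<alpha> * real n\<bar> \<le> 1" .
  qed
  show ?thesis
    by (rule upper_val_le_max[OF \<beta> short Tbar_orbit mem _ freq]) (use orb01 in auto)
qed

section \<open>The maximal slope and gaps of invariant sets\<close>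

lemma abs_ceiling_mult_le:
  assumes "\<bar>a - \<alpha>\<bar> \<le> 1"
  shows "\<bar>real_of_int \<lceil>a * real n\<rceil>\<bar> \<le> (\<bar>\<alpha>\<bar> + 1) * (real n + 1)"
proof -
  have "\<bar>a * real n\<bar> \<le> (\<bar>\<alpha>\<bar> + 1) * real n"
    unfolding abs_mult using assms by (intro mult_mono) auto
  moreover have "\<bar>real_of_int \<lceil>a * real n\<rceil>\<bar> \<le> \<bar>a * real n\<bar> + 1" by linarith
  ultimately show ?thesis by (simp add: algebra_simps)
qed

lemma upper_val_left:
  assumes "\<beta> > 1"
  shows "(\<lambda>j. upper_val \<beta> (\<alpha> - 1 / real (Suc j))) \<longlonglongrightarrow> upper_val \<beta> \<alpha>"
  unfolding upper_val_def
proof (rule wsum_tendsto[OF ratio_bounds(2,3)[OF assms], where C = "\<bar>\<alpha>\<bar> + 1"])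
  show "(\<lambda>j. real_of_int \<lceil>(\<alpha> - 1 / real (Suc j)) * real n\<rceil>) \<longlonglongrightarrow> of_int \<lceil>\<alpha> * real n\<rceil>" for n
  proof (rule tendsto_ceiling_left)
    have "(\<lambda>j. (\<alpha> - 1 / real (Suc j)) * real n) \<longlonglongrightarrow> (\<alpha> - 0) * real n"
      by (intro tendsto_intros LIMSEQ_Suc[OF lim_const_over_n])
    then show "(\<lambda>j. (\<alpha> - 1 / real (Suc j)) * real n) \<longlonglongrightarrow> \<alpha> * real n" by simp
    show "(\<alpha> - 1 / real (Suc j)) * real n \<le> \<alpha> * real n" for j
      by (intro mult_right_mono) auto
  qed
  show "\<bar>real_of_int \<lceil>(\<alpha> - 1 / real (Suc j)) * real n\<rceil>\<bar> \<le> (\<bar>\<alpha>\<bar> + 1) * (real n + 1)" for j n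
    by (rule abs_ceiling_mult_le) simp
qed

text \<open>Just above the slope every ceiling with \<open>n > 0\<close> becomes the floor plus 1,
  while the term at 0 stays 0. The limit is therefore the right end of the interval of length
  \<open>1 / \<beta>\<close> that starts at \<open>lower_val\<close>.\<close>

lemma upper_val_right:
  assumes "\<beta> > 1"
  shows "(\<lambda>j. upper_val \<beta> (\<alpha> + 1 / real (Suc j))) \<longlonglongrightarrow> lower_val \<beta> \<alpha> + 1 / \<beta>"
proof -
  have "(\<lambda>j. upper_val \<beta> (\<alpha> + 1 / real (Suc j)))
      \<longlonglongrightarrow> wsum (1 / \<beta>) (\<lambda>n. of_int \<lfloor>\<alpha> * real n\<rfloor> + (if n = 0 then 0 else 1))"
    unfolding upper_val_def
  proof (rule wsum_tendsto[OF ratio_bounds(2,3)[OF assms], where C = "\<bar>\<alpha>\<bar> + 1"])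
    show "(\<lambda>j. real_of_int \<lceil>(\<alpha> + 1 / real (Suc j)) * real n\<rceil>)
        \<longlonglongrightarrow> of_int \<lfloor>\<alpha> * real n\<rfloor> + (if n = 0 then 0 else 1)" for n
    proof (cases "n = 0")
      case False
      have "(\<lambda>j. real_of_int \<lceil>(\<alpha> + 1 / real (Suc j)) * real n\<rceil>) \<longlonglongrightarrow> of_int \<lfloor>\<alpha> * real n\<rfloor> + 1"
      proof (rule tendsto_ceiling_right)
        have "(\<lambda>j. (\<alpha> + 1 / real (Suc j)) * real n) \<longlonglongrightarrow> (\<alpha> + 0) * real n"
          by (intro tendsto_intros LIMSEQ_Suc[OF lim_const_over_n])
        then show "(\<lambda>j. (\<alpha> + 1 / real (Suc j)) * real n) \<longlonglongrightarrow> \<alpha> * real n" by simp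
        show "(\<alpha> + 1 / real (Suc j)) * real n > \<alpha> * real n" for j
          using False by (intro mult_strict_right_mono) auto
      qed
      then show ?thesis using False by simp
    qed simp
    show "\<bar>real_of_int \<lceil>(\<alpha> + 1 / real (Suc j)) * real n\<rceil>\<bar> \<le> (\<bar>\<alpha>\<bar> + 1) * (real n + 1)" for j n
      by (rule abs_ceiling_mult_le) simp
  qed
  also have "wsum (1 / \<beta>) (\<lambda>n. of_int \<lfloor>\<alpha> * real n\<rfloor> + (if n = 0 then 0 else 1)) = lower_val \<beta> \<alpha> + 1 / \<beta>"
    unfolding lower_val_def using wsum_if_pos[OF ratio_bounds(2,3)[OF assms], of 1]
    by (simp only: wsum_add[OF lin_bounded_floor lin_bounded_if_pos ratio_bounds(2,3)[OF assms]] mult_1)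
  finally show ?thesis .
qed

text \<open>Dropping the ceilings leaves \<open>\<alpha> / (\<beta> - 1)\<close>; hence slopes with
  value at most 1 are bounded by \<open>\<beta> - 1\<close>.\<close>

lemma upper_val_ge:
  assumes "\<beta> > 1"
  shows "\<alpha> \<le> (\<beta> - 1) * upper_val \<beta> \<alpha>"
proof -
  have "wsum (1 / \<beta>) (\<lambda>n. \<alpha> * real n) \<le> upper_val \<beta> \<alpha>"
    unfolding upper_val_def
    by (rule wsum_mono[OF lin_bounded_linear lin_bounded_ceiling ratio_bounds(2,3)[OF assms]]) simp
  moreover have "wsum (1 / \<beta>) (\<lambda>n. \<alpha> * real n) = \<alpha> / (\<beta> - 1)"
    using wsum_linear[OF ratio_bounds(2,3)[OF assms], of \<alpha>] assms by (simp add: field_simps)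
  ultimately show ?thesis using assms by (simp add: field_simps)
qed

text \<open>Take the supremum of the admissible slopes. Left-continuity makes it admissible, and all
  larger slopes have value above 1, so the right-hand limit is at least 1, which is the last
  claim.\<close>

lemma maximal_slope:
  assumes \<beta>: "\<beta> > 1"
  obtains a where "a > 0" "\<And>\<alpha>. \<alpha> > 0 \<Longrightarrow> upper_val \<beta> \<alpha> \<le> 1 \<longleftrightarrow> \<alpha> \<le> a" "1 - 1 / \<beta> \<le> lower_val \<beta> a"
proof -
  define E where "E = {\<alpha>. 0 < \<alpha> \<and> upper_val \<beta> \<alpha> \<le> 1}"
  \<comment> \<open>The right-hand limit at slope 0 is \<open>1 / \<beta> < 1\<close>, so small
    positive slopes are admissible.\<close>
  have "lower_val \<beta> 0 = 0" using wsum_const[OF ratio_bounds(2,3)[OF \<beta>], of 0] by (simp add: lower_val_def)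
  then have "lower_val \<beta> 0 + 1 / \<beta> < 1" using \<beta> by simp
  from order_tendstoD(2)[OF upper_val_right[OF \<beta>] this]
  obtain j where j: "upper_val \<beta> (0 + 1 / real (Suc j)) < 1"
    by (meson eventually_sequentially order_refl)
  then have e: "1 / real (Suc j) \<in> E" by (simp add: E_def)
  have ub: "\<alpha> \<le> \<beta> - 1" if "\<alpha> \<in> E" for \<alpha>
  proof -
    have "(\<beta> - 1) * upper_val \<beta> \<alpha> \<le> (\<beta> - 1) * 1"
      using that \<beta> by (intro mult_left_mono) (auto simp: E_def)
    then show ?thesis using upper_val_ge[OF \<beta>, of \<alpha>] by simp
  qed
  then have bdd: "bdd_above E" by (rule bdd_aboveI)
  define a where "a = Sup E"
  have a0: "a > 0" using cSup_upper[OF e bdd] unfolding a_def by (rule less_le_trans[rotated]) simp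
  have below: "upper_val \<beta> \<alpha> \<le> 1" if "\<alpha> < a" for \<alpha>
  proof -
    obtain \<alpha>' where "\<alpha>' \<in> E" "\<alpha> < \<alpha>'"
      using \<open>\<alpha> < a\<close> less_cSup_iff[OF _ bdd, of \<alpha>] e unfolding a_def by blast
    then show ?thesis using upper_val_strict_mono[OF \<beta>, of \<alpha> \<alpha>'] by (simp add: E_def)
  qed
  have at: "upper_val \<beta> a \<le> 1"
    by (rule LIMSEQ_le_const2[OF upper_val_left[OF \<beta>]]) (auto intro!: below)
  have above: "1 < upper_val \<beta> \<alpha>" if "\<alpha> > a" for \<alpha>
  proof (rule ccontr)
    assume "\<not> 1 < upper_val \<beta> \<alpha>"
    then have "\<alpha> \<in> E" using that a0 by (simp add: E_def)
    then show False using cSup_upper[OF _ bdd] that unfolding a_def by fastforce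
  qed
  have "1 \<le> lower_val \<beta> a + 1 / \<beta>"
    by (rule LIMSEQ_le_const[OF upper_val_right[OF \<beta>]]) (auto intro!: less_imp_le above)
  moreover have "upper_val \<beta> \<alpha> \<le> 1 \<longleftrightarrow> \<alpha> \<le> a" for \<alpha>
    using below[of \<alpha>] above[of \<alpha>] at by (cases \<alpha> a rule: linorder_cases) auto
  ultimately show ?thesis using that[OF a0] by simp
qed

section \<open>Gaps of short invariant sets\<close>

lemma short_ceiling:
  assumes "\<beta> > 1" "short \<beta> S" "u \<in> S" "v \<in> S" "u \<le> v"
  shows "\<beta> * u \<le> \<beta> * v" "\<beta> * v \<le> \<beta> * u + 1" "\<lceil>\<beta> * u\<rceil> \<le> \<lceil>\<beta> * v\<rceil>" "\<lceil>\<beta> * v\<rceil> \<le> \<lceil>\<beta> * u\<rceil> + 1"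
proof -
  show 1: "\<beta> * u \<le> \<beta> * v" using assms by simp
  have "v - u \<le> 1 / \<beta>" using assms by (simp add: short_def)
  then have "\<beta> * (v - u) \<le> 1" using mult_left_mono[of "v - u" "1 / \<beta>" \<beta>] assms(1) by simp
  then show 2: "\<beta> * v \<le> \<beta> * u + 1" by (simp add: right_diff_distrib)
  show "\<lceil>\<beta> * u\<rceil> \<le> \<lceil>\<beta> * v\<rceil>" using 1 by (rule ceiling_mono)
  show "\<lceil>\<beta> * v\<rceil> \<le> \<lceil>\<beta> * u\<rceil> + 1" using ceiling_mono[OF 2] by simp
qed

text \<open>A point of \<open>S'\<close> outside \<open>S\<close> lies in a gap of \<open>S\<close>. Gaps are mapped to gaps and expanded by
  the factor \<open>\<beta>\<close> until the discontinuity falls into one of them; the two ends of that gap are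
  mapped to the extreme points of \<open>S\<close>, hence the interior point is mapped beyond them.\<close>

lemma gap_step:
  assumes \<beta>: "\<beta> > 1" and S: "short \<beta> (S \<union> S')" "Tbar \<beta> ` S = S" "Tbar \<beta> ` S' \<subseteq> S'"
    and m: "m \<in> S" "M \<in> S" "\<And>y. y \<in> S' \<Longrightarrow> m \<le> y \<and> y \<le> M"
    and gap: "a \<in> S" "b \<in> S" "y \<in> S'" "a < y" "y < b" "\<And>s. s \<in> S \<Longrightarrow> s \<le> a \<or> b \<le> s"
  shows "Tbar \<beta> a < Tbar \<beta> y" "Tbar \<beta> y < Tbar \<beta> b" "Tbar \<beta> b - Tbar \<beta> a = \<beta> * (b - a)"
    "\<And>s. s \<in> S \<Longrightarrow> s \<le> Tbar \<beta> a \<or> Tbar \<beta> b \<le> s"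
proof -
  have T: "Tbar \<beta> u = \<beta> * u - of_int \<lceil>\<beta> * u\<rceil> + 1" for u by (simp add: Tbar_eq)
  have lt: "\<beta> * a < \<beta> * y" "\<beta> * y < \<beta> * b" using gap \<beta> by auto
  note sc = short_ceiling[OF \<beta> S(1)]
  have ay: "\<lceil>\<beta> * a\<rceil> \<le> \<lceil>\<beta> * y\<rceil>" "\<lceil>\<beta> * y\<rceil> \<le> \<lceil>\<beta> * b\<rceil>" "\<lceil>\<beta> * b\<rceil> \<le> \<lceil>\<beta> * a\<rceil> + 1"
    using sc[of a y] sc[of y b] sc[of a b] gap by auto
  \<comment> \<open>By surjectivity each point of \<open>S\<close> has a preimage in
    \<open>S\<close>, to the left or to the right of the gap. Shortness limits how far its digit can
    be from those of the ends.\<close>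
  have S_cases: "\<exists>z. s = Tbar \<beta> z \<and> (\<beta> * z \<le> \<beta> * a \<and> \<beta> * b \<le> \<beta> * z + 1 \<and>
      \<lceil>\<beta> * z\<rceil> \<le> \<lceil>\<beta> * a\<rceil> \<and> \<lceil>\<beta> * b\<rceil> \<le> \<lceil>\<beta> * z\<rceil> + 1 \<or>
      \<beta> * b \<le> \<beta> * z \<and> \<beta> * z \<le> \<beta> * a + 1 \<and>
      \<lceil>\<beta> * b\<rceil> \<le> \<lceil>\<beta> * z\<rceil> \<and> \<lceil>\<beta> * z\<rceil> \<le> \<lceil>\<beta> * a\<rceil> + 1)" if "s \<in> S" for s
  proof -
    obtain z where z: "z \<in> S" "s = Tbar \<beta> z" using S(2) \<open>s \<in> S\<close> by blast
    show ?thesis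
    proof (cases "z \<le> a")
      case True
      then have "z \<le> b" using gap by simp
      then show ?thesis using sc[of z a] sc[of z b] True z gap(1,2) by auto
    next
      case False
      then have "b \<le> z" using gap(6)[OF z(1)] by simp
      then have "a \<le> z" using gap by simp
      then show ?thesis using sc[of a z] sc[of b z] \<open>b \<le> z\<close> z gap(1,2) by auto
    qed
  qed
  have Ty: "m \<le> Tbar \<beta> y" "Tbar \<beta> y \<le> M" using m(3)[of "Tbar \<beta> y"] S(3) gap(3) by auto
  have eq: "\<lceil>\<beta> * b\<rceil> = \<lceil>\<beta> * a\<rceil>"
  proof (rule ccontr)
    assume "\<lceil>\<beta> * b\<rceil> \<noteq> \<lceil>\<beta> * a\<rceil>"
    then have ba: "\<lceil>\<beta> * b\<rceil> = \<lceil>\<beta> * a\<rceil> + 1" using ay by linarith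
    \<comment> \<open>If the digits of the ends differ, their images enclose all of
      \<open>S\<close>, in particular \<open>m\<close> and \<open>M\<close>, but the image of
      \<open>y\<close> passes one of them.\<close>
    have ext: "Tbar \<beta> b \<le> s \<and> s \<le> Tbar \<beta> a" if s: "s \<in> S" for s
    proof -
      obtain z where z: "s = Tbar \<beta> z" and "\<beta> * z \<le> \<beta> * a \<and> \<beta> * b \<le> \<beta> * z + 1 \<and>
          \<lceil>\<beta> * z\<rceil> \<le> \<lceil>\<beta> * a\<rceil> \<and> \<lceil>\<beta> * b\<rceil> \<le> \<lceil>\<beta> * z\<rceil> + 1 \<or>
          \<beta> * b \<le> \<beta> * z \<and> \<beta> * z \<le> \<beta> * a + 1 \<and>
          \<lceil>\<beta> * b\<rceil> \<le> \<lceil>\<beta> * z\<rceil> \<and> \<lceil>\<beta> * z\<rceil> \<le> \<lceil>\<beta> * a\<rceil> + 1"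
        using S_cases[OF s] by blast
      then show ?thesis
      proof (elim disjE conjE)
        assume *: "\<beta> * z \<le> \<beta> * a" "\<beta> * b \<le> \<beta> * z + 1" "\<lceil>\<beta> * z\<rceil> \<le> \<lceil>\<beta> * a\<rceil>" "\<lceil>\<beta> * b\<rceil> \<le> \<lceil>\<beta> * z\<rceil> + 1"
        have "\<lceil>\<beta> * z\<rceil> = \<lceil>\<beta> * a\<rceil>" using * ba by linarith
        then show ?thesis unfolding z T ba using * by simp
      next
        assume *: "\<beta> * b \<le> \<beta> * z" "\<beta> * z \<le> \<beta> * a + 1" "\<lceil>\<beta> * b\<rceil> \<le> \<lceil>\<beta> * z\<rceil>" "\<lceil>\<beta> * z\<rceil> \<le> \<lceil>\<beta> * a\<rceil> + 1"
        have "\<lceil>\<beta> * z\<rceil> = \<lceil>\<beta> * a\<rceil> + 1" using * ba by linarith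
        then show ?thesis unfolding z T ba using * by simp
      qed
    qed
    have "\<lceil>\<beta> * y\<rceil> = \<lceil>\<beta> * a\<rceil> \<or> \<lceil>\<beta> * y\<rceil> = \<lceil>\<beta> * b\<rceil>" using ay ba by linarith
    then have "Tbar \<beta> a < Tbar \<beta> y \<or> Tbar \<beta> y < Tbar \<beta> b" unfolding T using lt by auto
    then show False using ext[OF m(1)] ext[OF m(2)] Ty by linarith
  qed
  then have "\<lceil>\<beta> * y\<rceil> = \<lceil>\<beta> * a\<rceil>" using ay by linarith
  then show "Tbar \<beta> a < Tbar \<beta> y" "Tbar \<beta> y < Tbar \<beta> b" unfolding T using lt eq by auto
  show "Tbar \<beta> b - Tbar \<beta> a = \<beta> * (b - a)" unfolding T eq by (simp add: right_diff_distrib)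
  fix s assume "s \<in> S"
  then obtain z where z: "s = Tbar \<beta> z" and "\<beta> * z \<le> \<beta> * a \<and> \<beta> * b \<le> \<beta> * z + 1 \<and>
      \<lceil>\<beta> * z\<rceil> \<le> \<lceil>\<beta> * a\<rceil> \<and> \<lceil>\<beta> * b\<rceil> \<le> \<lceil>\<beta> * z\<rceil> + 1 \<or>
      \<beta> * b \<le> \<beta> * z \<and> \<beta> * z \<le> \<beta> * a + 1 \<and>
      \<lceil>\<beta> * b\<rceil> \<le> \<lceil>\<beta> * z\<rceil> \<and> \<lceil>\<beta> * z\<rceil> \<le> \<lceil>\<beta> * a\<rceil> + 1"
    using S_cases by blast
  then show "s \<le> Tbar \<beta> a \<or> Tbar \<beta> b \<le> s"
  proof (elim disjE conjE)
    assume *: "\<beta> * z \<le> \<beta> * a" "\<beta> * b \<le> \<beta> * z + 1" "\<lceil>\<beta> * z\<rceil> \<le> \<lceil>\<beta> * a\<rceil>" "\<lceil>\<beta> * b\<rceil> \<le> \<lceil>\<beta> * z\<rceil> + 1"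
    have "\<lceil>\<beta> * z\<rceil> = \<lceil>\<beta> * a\<rceil> \<or> \<lceil>\<beta> * a\<rceil> = \<lceil>\<beta> * z\<rceil> + 1" using * eq by linarith
    then show ?thesis unfolding z T eq using * by auto
  next
    assume *: "\<beta> * b \<le> \<beta> * z" "\<beta> * z \<le> \<beta> * a + 1" "\<lceil>\<beta> * b\<rceil> \<le> \<lceil>\<beta> * z\<rceil>" "\<lceil>\<beta> * z\<rceil> \<le> \<lceil>\<beta> * a\<rceil> + 1"
    have "\<lceil>\<beta> * z\<rceil> = \<lceil>\<beta> * a\<rceil> \<or> \<lceil>\<beta> * z\<rceil> = \<lceil>\<beta> * a\<rceil> + 1" using * eq by linarith
    then show ?thesis unfolding z T eq using * by auto
  qed
qed

text \<open>Both ends of the gap stay in \<open>S\<close> under iteration while its length grows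
  like \<open>\<beta> ^ n\<close>, which contradicts shortness.\<close>

lemma subset_of_extremes:
  assumes \<beta>: "\<beta> > 1" and S: "short \<beta> (S \<union> S')" "closed S" "Tbar \<beta> ` S = S" "Tbar \<beta> ` S' \<subseteq> S'"
    and m: "m \<in> S" "M \<in> S" "\<And>y. y \<in> S' \<Longrightarrow> m \<le> y \<and> y \<le> M"
  shows "S' \<subseteq> S"
proof (rule ccontr)
  assume "\<not> S' \<subseteq> S"
  then obtain y where y: "y \<in> S'" "y \<notin> S" by blast
  define gap where "gap a y b \<longleftrightarrow> a \<in> S \<and> b \<in> S \<and> y \<in> S' \<and> a < y \<and> y < b \<and> (\<forall>s\<in>S. s \<le> a \<or> b \<le> s)" for a y b
  have my: "m \<le> y" "y \<le> M" using m(3)[OF y(1)] by auto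
  \<comment> \<open>The nearest points of \<open>S\<close> on either side of \<open>y\<close> exist
    because \<open>S\<close> is closed and \<open>m\<close>, \<open>M\<close> enclose
    \<open>y\<close>.\<close>
  define a where "a = Sup (S \<inter> {..y})"
  define b where "b = Inf (S \<inter> {y..})"
  have a: "a \<in> S \<inter> {..y}" unfolding a_def
    by (rule closed_contains_Sup) (use m my S(2) in \<open>auto intro!: closed_Int\<close>)
  have b: "b \<in> S \<inter> {y..}" unfolding b_def
    by (rule closed_contains_Inf) (use m my S(2) in \<open>auto intro!: closed_Int\<close>)
  have "s \<le> a \<or> b \<le> s" if "s \<in> S" for s
  proof (cases "s \<le> y")
    case True
    then have "s \<le> a" unfolding a_def using that by (intro cSup_upper) auto
    then show ?thesis ..
  next
    case False
    then have "b \<le> s" unfolding b_def using that by (intro cInf_lower) auto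
    then show ?thesis ..
  qed
  moreover have "a < y" "y < b" using a b y(2) by (auto simp: less_le)
  ultimately have gap0: "gap a y b" using a b y(1) by (auto simp: gap_def)
  have step: "gap (Tbar \<beta> u) (Tbar \<beta> v) (Tbar \<beta> w) \<and> Tbar \<beta> w - Tbar \<beta> u = \<beta> * (w - u)" if "gap u v w" for u v w
  proof -
    have g: "u \<in> S" "w \<in> S" "v \<in> S'" "u < v" "v < w" "\<And>s. s \<in> S \<Longrightarrow> s \<le> u \<or> w \<le> s"
      using that by (auto simp: gap_def)
    have "Tbar \<beta> u \<in> S" "Tbar \<beta> w \<in> S" "Tbar \<beta> v \<in> S'" using g S by auto
    then show ?thesis
      using gap_step[OF \<beta> S(1,3,4) m g] unfolding gap_def by blast
  qed
  have iter: "\<exists>u v w. gap u v w \<and> w - u = \<beta> ^ n * (b - a)" for n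
  proof (induction n)
    case 0
    then show ?case using gap0 by auto
  next
    case (Suc n)
    then obtain u v w where *: "gap u v w" "w - u = \<beta> ^ n * (b - a)" by blast
    have "Tbar \<beta> w - Tbar \<beta> u = \<beta> ^ Suc n * (b - a)" using step[OF *(1)] *(2) by simp
    then show ?case using step[OF *(1)] by blast
  qed
  have ba: "b - a > 0" using \<open>a < y\<close> \<open>y < b\<close> by simp
  obtain n where "1 / \<beta> / (b - a) < \<beta> ^ n" using real_arch_pow[OF \<beta>] by blast
  then have "1 / \<beta> < \<beta> ^ n * (b - a)" by (simp only: pos_divide_less_eq[OF ba])
  moreover obtain u v w where "gap u v w" "w - u = \<beta> ^ n * (b - a)" using iter by blast
  moreover have "w - u \<le> 1 / \<beta>" using \<open>gap u v w\<close> S(1) by (auto simp: gap_def short_def)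
  ultimately show False by linarith
qed

section \<open>Uniqueness of the orbit closure\<close>

lemma dsum_multiples: "dsum \<beta> y (J * n) = (\<Sum>j<J. dsum \<beta> ((Tbar \<beta> ^^ (j * n)) y) n)"
proof (induction J)
  case (Suc J)
  then show ?case using dsum_add[of \<beta> y "J * n" n] by (simp add: add.commute)
qed simp

lemma orbit_mem: "(Tbar \<beta> ^^ n) x \<in> orbit \<beta> x"
  by (simp add: orbit_def)

lemma orbit_closure_mem: "(Tbar \<beta> ^^ n) x \<in> closure (orbit \<beta> x)"
  using orbit_mem by (rule closure_subset[THEN subsetD])

text \<open>Surjectivity makes \<open>x\<close> periodic or recurrent. Either way a property that holds at some point
  of the orbit and is open and closed in \<open>S\<close> holds infinitely often along the orbit.\<close>

lemma visits_infinite: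
  assumes \<beta>: "\<beta> > 1" and S: "S = closure (orbit \<beta> x)" "Tbar \<beta> ` S = S" "S \<subseteq> {e..}" "e > 0"
    and h: "continuous_on S h" and i: "h ((Tbar \<beta> ^^ i) x) \<noteq> (0::real)"
  shows "infinite {i. h ((Tbar \<beta> ^^ i) x) \<noteq> 0}"
proof -
  let ?F = "{i. h ((Tbar \<beta> ^^ i) x) \<noteq> 0}"
  have inv: "Tbar \<beta> ` S \<subseteq> S" using S(2) by simp
  have "x \<in> S" unfolding S(1) using orbit_closure_mem[of 0 \<beta> x] by simp
  then have "x \<in> Tbar \<beta> ` S" by (simp only: S(2))
  then obtain z where z: "z \<in> S" "Tbar \<beta> z = x" by (auto simp only: image_iff)
  show ?thesis
  proof (cases "z \<in> orbit \<beta> x")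
    case True
    then obtain j where j: "z = (Tbar \<beta> ^^ j) x" by (auto simp: orbit_def)
    \<comment> \<open>The preimage \<open>z\<close> of \<open>x\<close> is reached after
      \<open>j\<close> steps, so \<open>x\<close> returns to itself after
      \<open>Suc j\<close>.\<close>
    have per: "(Tbar \<beta> ^^ (l * Suc j)) x = x" for l
    proof (induction l)
      case (Suc l)
      have "(Tbar \<beta> ^^ (Suc l * Suc j)) x = (Tbar \<beta> ^^ Suc j) ((Tbar \<beta> ^^ (l * Suc j)) x)"
        unfolding mult_Suc funpow_add comp_apply ..
      then show ?case unfolding Suc using j z(2) by simp
    qed simp
    have "i + l * Suc j \<in> ?F" for l
      using i per[of l] by (simp only: funpow_add comp_apply mem_Collect_eq not_False_eq_True)
    then have "range (\<lambda>l. i + l * Suc j) \<subseteq> ?F" by blast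
    moreover have "infinite (range (\<lambda>l. i + l * Suc j))"
      by (rule range_inj_infinite) (simp only: inj_on_def add_left_cancel mult_cancel2, simp)
    ultimately show ?thesis by (rule infinite_super)
  next
    case False
    \<comment> \<open>Looking \<open>Suc i\<close> steps ahead, \<open>h'\<close> at
      \<open>z\<close> sees the given nonzero value, since \<open>z\<close> maps to
      \<open>x\<close>.\<close>
    define h' where "h' y = h ((Tbar \<beta> ^^ Suc i) y)" for y
    have "(Tbar \<beta> ^^ Suc i) ` S \<subseteq> S" using funpow_invariant[OF inv] by blast
    then have "continuous_on S (h \<circ> (Tbar \<beta> ^^ Suc i))"
      by (intro continuous_on_compose continuous_on_funpow_Tbar[OF \<beta> inv S(3,4)] continuous_on_subset[OF h])
    moreover have "h' = h \<circ> (Tbar \<beta> ^^ Suc i)" by (simp add: h'_def fun_eq_iff)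
    ultimately have cont: "continuous_on S h'" by simp
    have inf: "infinite {j. h' ((Tbar \<beta> ^^ j) x) \<noteq> 0}"
    proof
      \<comment> \<open>Finitely many exceptional points together with the closed zero set of
        \<open>h'\<close> would cover the closure. As \<open>z\<close> is off the orbit, it would
        have to be a zero.\<close>
      assume fin: "finite {j. h' ((Tbar \<beta> ^^ j) x) \<noteq> 0}"
      let ?P = "(\<lambda>j. (Tbar \<beta> ^^ j) x) ` {j. h' ((Tbar \<beta> ^^ j) x) \<noteq> 0}"
      let ?Q = "{y \<in> S. h' y = 0}"
      have "closed S" using S(1) by simp
      then have "closed ?Q" by (rule continuous_closed_preimage_constant[OF cont])
      moreover have "closed ?P" using fin by (intro finite_imp_closed finite_imageI)
      ultimately have "closed (?P \<union> ?Q)" by (rule closed_Un[rotated])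
      moreover have "orbit \<beta> x \<subseteq> ?P \<union> ?Q"
      proof
        fix y assume "y \<in> orbit \<beta> x"
        then obtain j where y: "y = (Tbar \<beta> ^^ j) x" by (auto simp: orbit_def)
        have "y \<in> S" unfolding y S(1) by (rule orbit_closure_mem)
        then show "y \<in> ?P \<union> ?Q" using y by (cases "h' y = 0") auto
      qed
      ultimately have "S \<subseteq> ?P \<union> ?Q" unfolding S(1) by (rule closure_minimal[rotated])
      moreover have "z \<notin> ?P" using False by (auto simp: orbit_def)
      ultimately have "h' z = 0" using z(1) by blast
      moreover have "h' z = h ((Tbar \<beta> ^^ i) x)"
        unfolding h'_def funpow_Suc_right comp_apply z(2) ..
      ultimately show False using i by simp
    qed
    have sub: "(\<lambda>j. Suc i + j) ` {j. h' ((Tbar \<beta> ^^ j) x) \<noteq> 0} \<subseteq> ?F"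
      by (auto simp: h'_def funpow_add)
    have inj: "inj_on (\<lambda>j. Suc i + j) {j. h' ((Tbar \<beta> ^^ j) x) \<noteq> 0}" by (simp add: inj_on_def)
    show ?thesis
      by (rule infinite_super[OF sub]) (use finite_image_iff[OF inj] inf in simp)
  qed
qed

text \<open>The setting in which the frequency alone determines the extreme points \<open>m\<close>
  and \<open>M\<close>.\<close>

locale short_orbit_closure =
  fixes \<beta> \<alpha> x e m M :: real and S :: "real set"
  assumes \<beta>: "\<beta> > 1" and S: "S = closure (orbit \<beta> x)" "Tbar \<beta> ` S = S" "S \<subseteq> {e..1}" "e > 0"
    and short: "short \<beta> S" and freq: "set_has_frequency \<beta> S \<alpha>"
    and m: "m \<in> S" "\<And>y. y \<in> S \<Longrightarrow> m \<le> y" and M: "M \<in> S" "\<And>y. y \<in> S \<Longrightarrow> y \<le> M"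
begin

lemma inv: "Tbar \<beta> ` S \<subseteq> S"
  using S(2) by simp

lemma dsum_m_le: "dsum \<beta> m n \<le> \<alpha> * real n"
  by (rule dsum_min_le[OF \<beta> short inv m]) (use freq m in \<open>simp_all add: set_has_frequency_def\<close>)

lemma dsum_M_ge: "\<alpha> * real n \<le> dsum \<beta> M n"
  by (rule dsum_max_ge[OF \<beta> short inv M]) (use freq M in \<open>simp_all add: set_has_frequency_def\<close>)

lemma dsum_between: "y \<in> S \<Longrightarrow> dsum \<beta> m n \<le> dsum \<beta> y n \<and> dsum \<beta> y n \<le> dsum \<beta> M n"
  using dsum_mono(1)[OF \<beta> short inv] m M by blast

lemma dsum_M_le: "dsum \<beta> M n \<le> dsum \<beta> m n + 1"
  using dsum_mono(2)[OF \<beta> short inv] m M by blast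

lemma dsum_near: "y \<in> S \<Longrightarrow> \<bar>dsum \<beta> y n - \<alpha> * real n\<bar> \<le> 1"
  using dsum_between[of y n] dsum_M_le[of n] dsum_m_le[of n] dsum_M_ge[of n] by linarith

text \<open>The excess \<open>dsum \<beta> y n - p\<close> has constant sign, and along the orbit it sums to a bounded
  quantity in every residue class modulo \<open>n\<close>; so it is nonzero only finitely often.\<close>

lemma dsum_integer_slope:
  assumes n: "n > 0" and p: "\<alpha> * real n = of_int p" and y: "y \<in> S"
  shows "dsum \<beta> y n = of_int p"
proof -
  define D where "D y = (\<Sum>k<n. dbar \<beta> y k)" for y
  have D: "dsum \<beta> y n = of_int (D y)" for y by (simp add: D_def dsum_def)
  have b: "D m \<le> p" "p \<le> D M" "D M \<le> D m + 1"
    using dsum_m_le[of n] dsum_M_ge[of n] dsum_M_le[of n] unfolding D p by linarith+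
  have b': "D m \<le> D u \<and> D u \<le> D M" if "u \<in> S" for u
    using dsum_between[OF that, of n] unfolding D by simp
  \<comment> \<open>The integers \<open>D m\<close> and \<open>D M\<close> enclose \<open>p\<close>
    and differ by at most 1, so \<open>p\<close> equals one of them; the sign makes the excess 0 or
    1 everywhere on \<open>S\<close>.\<close>
  define s :: int where "s = (if p = D m then 1 else -1)"
  have s: "s = 1 \<or> s = -1" by (simp add: s_def)
  have h01: "s * (D u - p) = 0 \<or> s * (D u - p) = 1" if "u \<in> S" for u
    using b b'[OF that] by (auto simp: s_def)
  define h where "h u = real_of_int (s * (D u - p))" for u
  have h_nonneg: "0 \<le> h u" if "u \<in> S" for u
    using h01[OF that] unfolding h_def by (elim disjE) (simp_all only: of_int_0 of_int_1 order_refl zero_le_one)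
  have h_1: "h u = 1" if "u \<in> S" "h u \<noteq> 0" for u
    using h01[OF that(1)] that(2) unfolding h_def by (elim disjE) (simp_all only: of_int_0 of_int_1)
  have h_dsum: "h u = of_int s * (dsum \<beta> u n - of_int p)" for u by (simp add: h_def D)
  have e: "S \<subseteq> {e..}" using S(3) by auto
  have memS: "(Tbar \<beta> ^^ k) u \<in> S" if "u \<in> S" for k u using that by (rule funpow_invariant[OF inv])
  have hsum: "(\<Sum>j<J. h ((Tbar \<beta> ^^ (j * n)) u)) \<le> 1" if "u \<in> S" for u J
  proof -
    have "(\<Sum>j<J. h ((Tbar \<beta> ^^ (j * n)) u)) = of_int s * (dsum \<beta> u (J * n) - real J * of_int p)"
      by (simp add: h_dsum dsum_multiples sum_distrib_left[symmetric] sum_subtractf)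
    also have "\<dots> = of_int s * (dsum \<beta> u (J * n) - \<alpha> * real (J * n))"
      unfolding p[symmetric] by (simp add: algebra_simps)
    also have "\<dots> \<le> 1"
      using dsum_near[OF that, of "J * n"] s by auto
    finally show ?thesis .
  qed
  let ?F = "{i. h ((Tbar \<beta> ^^ i) x) \<noteq> 0}"
  have xS: "(Tbar \<beta> ^^ k) x \<in> S" for k unfolding S(1) by (rule orbit_closure_mem)
  \<comment> \<open>Two nonzero excesses in one residue class would sum to 2, above the bound
    \<open>hsum\<close>. So there are at most \<open>n\<close> of them along the orbit.\<close>
  have no_two: False if ij: "i < j" "i \<in> ?F" "j \<in> ?F" "i mod n = j mod n" for i j
  proof -
    have "n dvd j - i" using ij(1,4) by (metis mod_eq_dvd_iff_nat less_imp_le_nat)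
    then obtain J where "j - i = n * J" by (elim dvdE)
    then have J: "j = J * n + i" "J > 0" using ij(1) by (auto simp: algebra_simps intro!: gr0I)
    define u where "u = (Tbar \<beta> ^^ i) x"
    have uS: "u \<in> S" unfolding u_def by (rule xS)
    have "h ((Tbar \<beta> ^^ (0 * n)) u) = 1" using ij(2) h_1[OF uS] by (simp add: u_def)
    moreover have "h ((Tbar \<beta> ^^ (J * n)) u) = 1"
      using ij(3) h_1[OF memS[OF uS]] unfolding u_def J(1) by (simp add: funpow_add)
    moreover have "(\<Sum>k\<in>{0, J}. h ((Tbar \<beta> ^^ (k * n)) u)) \<le> (\<Sum>k<Suc J. h ((Tbar \<beta> ^^ (k * n)) u))"
      by (rule sum_mono2) (use h_nonneg memS uS in auto)
    ultimately show False using hsum[OF uS, of "Suc J"] J(2) by simp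
  qed
  have "inj_on (\<lambda>i. i mod n) ?F"
  proof (rule inj_onI)
    fix i j assume "i \<in> ?F" "j \<in> ?F" "i mod n = j mod n"
    then show "i = j" using no_two[of i j] no_two[of j i] by (cases i j rule: linorder_cases) auto
  qed
  moreover have "finite ((\<lambda>i. i mod n) ` ?F)"
    by (rule finite_subset[of _ "{..<n}"]) (use n in auto)
  ultimately have fin: "finite ?F" by (rule finite_imageD[rotated])
  have cont: "continuous_on S h"
    unfolding h_dsum by (intro continuous_intros continuous_on_dsum[OF \<beta> inv e S(4)])
  have "h ((Tbar \<beta> ^^ i) x) = 0" for i
    using visits_infinite[OF \<beta> S(1,2) e S(4) cont, of i] fin by blast
  then have "norm (h u) \<le> 0" if "u \<in> orbit \<beta> x" for u using that by (auto simp: orbit_def)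
  then have "norm (h y) \<le> 0"
    by (intro continuous_on_closure_norm_le[OF cont[unfolded S(1)] _ y[unfolded S(1)]] ballI)
  then show ?thesis using s by (auto simp: h_def D)
qed

text \<open>When \<open>\<alpha> * n\<close> is an integer, all digit sums of length
  \<open>n\<close> equal it. Otherwise it lies strictly between two integers differing by at most 1,
  which must be its floor and ceiling.\<close>

lemma dsum_extremes:
  "dsum \<beta> M n = of_int \<lceil>\<alpha> * real n\<rceil>" "dsum \<beta> m n = of_int \<lfloor>\<alpha> * real n\<rfloor>"
proof -
  obtain p q where p: "dsum \<beta> M n = of_int p" and q: "dsum \<beta> m n = of_int q"
    using dsum_Ints by (metis Ints_cases)
  have "p = \<lceil>\<alpha> * real n\<rceil> \<and> q = \<lfloor>\<alpha> * real n\<rfloor>"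
  proof (cases "\<alpha> * real n \<in> \<int>")
    case True
    then obtain k where k: "\<alpha> * real n = of_int k" by (elim Ints_cases)
    show ?thesis
    proof (cases "n = 0")
      case True
      then show ?thesis using p q by simp
    next
      case False
      then show ?thesis using dsum_integer_slope[OF _ k M(1)] dsum_integer_slope[OF _ k m(1)] p q k by simp
    qed
  next
    case False
    have "\<lceil>\<alpha> * real n\<rceil> \<le> p" "q \<le> \<lfloor>\<alpha> * real n\<rfloor>" "p \<le> q + 1"
      using dsum_M_ge[of n] dsum_m_le[of n] dsum_M_le[of n] unfolding p q
      by (simp_all add: ceiling_le_iff le_floor_iff)
    moreover have "\<lceil>\<alpha> * real n\<rceil> = \<lfloor>\<alpha> * real n\<rfloor> + 1"
      using False by (metis Ints_of_int ceiling_altdef)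
    ultimately show ?thesis by linarith
  qed
  then show "dsum \<beta> M n = of_int \<lceil>\<alpha> * real n\<rceil>" "dsum \<beta> m n = of_int \<lfloor>\<alpha> * real n\<rfloor>"
    using p q by auto
qed

lemma extremes: "M = upper_val \<beta> \<alpha>" "m = lower_val \<beta> \<alpha>"
proof -
  have "M \<in> {0..1}" "m \<in> {0..1}" using M(1) m(1) S(3,4) by auto
  moreover have "dsum \<beta> M = (\<lambda>n. of_int \<lceil>\<alpha> * real n\<rceil>)" "dsum \<beta> m = (\<lambda>n. of_int \<lfloor>\<alpha> * real n\<rfloor>)"
    using dsum_extremes by auto
  ultimately show "M = upper_val \<beta> \<alpha>" "m = lower_val \<beta> \<alpha>"
    unfolding upper_val_def lower_val_def using wsum_dsum[OF \<beta>, of M] wsum_dsum[OF \<beta>, of m] by simp_all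
qed

end

lemma extremes_of_closure:
  assumes \<beta>: "\<beta> > 1" and S: "invariant_orbit_closure \<beta> S" "S \<subseteq> {1 - 1 / \<beta>..1}" "set_has_frequency \<beta> S \<alpha>"
  shows "lower_val \<beta> \<alpha> \<in> S" "upper_val \<beta> \<alpha> \<in> S" "S \<subseteq> {lower_val \<beta> \<alpha>..upper_val \<beta> \<alpha>}"
proof -
  obtain x where x: "S = closure (orbit \<beta> x)" "Tbar \<beta> ` S = S"
    using S(1) unfolding invariant_orbit_closure_def orbit_closure_iff by blast
  have "bounded S" using S(2) by (rule bounded_subset[OF bounded_closed_interval])
  then have "compact S" unfolding compact_eq_bounded_closed using x(1) by simp
  moreover have "S \<noteq> {}" using orbit_closure_mem[of 0 \<beta> x] x(1) by blast
  ultimately have "\<exists>m\<in>S. \<forall>y\<in>S. m \<le> y" "\<exists>M\<in>S. \<forall>y\<in>S. y \<le> M"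
    by (rule compact_attains_inf, rule compact_attains_sup)
  then obtain m M where m: "m \<in> S" "\<And>y. y \<in> S \<Longrightarrow> m \<le> y" and M: "M \<in> S" "\<And>y. y \<in> S \<Longrightarrow> y \<le> M"
    by blast
  interpret short_orbit_closure \<beta> \<alpha> x "1 - 1 / \<beta>" m M S
  proof
    show "short \<beta> S" by (rule short_subset_interval[of _ "1 - 1 / \<beta>"]) (use S(2) in simp)
  qed (use \<beta> x S m M in simp_all)
  show "lower_val \<beta> \<alpha> \<in> S" "upper_val \<beta> \<alpha> \<in> S" "S \<subseteq> {lower_val \<beta> \<alpha>..upper_val \<beta> \<alpha>}"
    using m M unfolding extremes by auto
qed

text \<open>Both sets lie in one short interval, so their digit sums are balanced against each other
  and \<open>S'\<close> inherits the frequency. Hence the extreme points coincide, and the gap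
  argument gives both inclusions.\<close>

lemma unique_closure:
  assumes \<beta>: "\<beta> > 1"
    and S: "invariant_orbit_closure \<beta> S" "S \<subseteq> {1 - 1 / \<beta>..1}" "set_has_frequency \<beta> S \<alpha>"
    and S': "invariant_orbit_closure \<beta> S'" "S' \<subseteq> {1 - 1 / \<beta>..1}"
  shows "S' = S"
proof -
  have un: "S \<union> S' \<subseteq> {1 - 1 / \<beta>..1 - 1 / \<beta> + 1 / \<beta>}" using S(2) S'(2) by simp
  then have short: "short \<beta> (S \<union> S')" by (rule short_subset_interval)
  have T: "Tbar \<beta> ` S = S" "Tbar \<beta> ` S' = S'" and cl: "closed S" "closed S'"
    using S(1) S'(1) unfolding invariant_orbit_closure_def orbit_closure_iff by auto
  note ext = extremes_of_closure[OF \<beta> S]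
  have "set_has_frequency \<beta> S' \<alpha>"
    unfolding set_has_frequency_def
  proof
    fix y assume "y \<in> S'"
    moreover have "Tbar \<beta> ` (S \<union> S') \<subseteq> S \<union> S'" using T by blast
    ultimately have "\<bar>dsum \<beta> y n - dsum \<beta> (upper_val \<beta> \<alpha>) n\<bar> \<le> 1" for n
      using dsum_balanced[OF \<beta> short, of "upper_val \<beta> \<alpha>" y n] ext(2) by blast
    moreover have "point_has_frequency \<beta> (upper_val \<beta> \<alpha>) \<alpha>"
      using S(3) ext(2) by (simp add: set_has_frequency_def)
    ultimately show "point_has_frequency \<beta> y \<alpha>" by (rule point_has_frequency_transfer[rotated])
  qed
  note ext' = extremes_of_closure[OF \<beta> S' this]
  show ?thesis
  proof
    show "S' \<subseteq> S"
      by (rule subset_of_extremes[OF \<beta> short cl(1) T(1) equalityD1[OF T(2)] ext(1,2)]) (use ext'(3) in auto)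
    have "short \<beta> (S' \<union> S)" using short by (simp add: Un_commute)
    then show "S \<subseteq> S'"
      by (rule subset_of_extremes[OF \<beta> _ cl(2) T(2) equalityD1[OF T(1)] ext'(1,2)]) (use ext(3) in auto)
  qed
qed

section \<open>Identification of \<open>Freq\<close> with the maximal slope\<close>

lemma Freq_eq:
  assumes \<beta>: "\<beta> > 1" and a: "a > 0" "upper_val \<beta> a \<le> 1" "1 - 1 / \<beta> \<le> lower_val \<beta> a" and nonint: "\<beta> \<notin> \<int>"
  shows "Freq \<beta> = a"
proof -
  let ?S = "closure (orbit \<beta> (upper_val \<beta> a))"
  note S = mechanical_closure[OF \<beta> a(1,2)]
  have sub: "?S \<subseteq> {1 - 1 / \<beta>..1}" using S(2) a(2,3) by fastforce
  \<comment> \<open>The hypothesis on \<open>lower_val\<close> puts the mechanical closure inside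
    \<open>[1 - 1/\<beta>, 1]\<close>, where uniqueness justifies the description.\<close>
  have "(THE S. invariant_orbit_closure \<beta> S \<and> S \<subseteq> {1 - 1 / \<beta>..1}) = ?S"
    by (rule the_equality) (use S(1) sub unique_closure[OF \<beta> S(1) sub S(3)] in blast)+
  moreover have "(THE \<alpha>. set_has_frequency \<beta> ?S \<alpha>) = a"
  proof (rule the_equality)
    show "set_has_frequency \<beta> ?S a" by (rule S(3))
    fix \<alpha> assume "set_has_frequency \<beta> ?S \<alpha>"
    moreover have "upper_val \<beta> a \<in> ?S" using orbit_closure_mem[of 0 \<beta>] by simp
    ultimately have "point_has_frequency \<beta> (upper_val \<beta> a) \<alpha>" "point_has_frequency \<beta> (upper_val \<beta> a) a"
      using S(3) by (auto simp: set_has_frequency_def)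
    then show "\<alpha> = a" unfolding point_has_frequency_def by (rule LIMSEQ_unique)
  qed
  ultimately show ?thesis using nonint by (simp add: Freq_def)
qed

text \<open>In an integer base the slope \<open>\<beta> - 1\<close> is an integer, so the ceilings
  disappear and the linear sum remains.\<close>

lemma upper_val_int:
  assumes "\<beta> > 1" "\<beta> \<in> \<int>"
  shows "upper_val \<beta> (\<beta> - 1) = 1"
proof -
  obtain k where k: "\<beta> = of_int k" using assms(2) by (elim Ints_cases)
  have "real_of_int \<lceil>(\<beta> - 1) * real n\<rceil> = (\<beta> - 1) * real n" for n
  proof -
    have "(\<beta> - 1) * real n = of_int ((k - 1) * int n)" by (simp add: k)
    then show ?thesis by (simp only: ceiling_of_int)
  qed
  then have "upper_val \<beta> (\<beta> - 1) = (\<beta> - 1) * (1 / \<beta>) / (1 - 1 / \<beta>)"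
    unfolding upper_val_def by (simp only: wsum_linear[OF ratio_bounds(2,3)[OF assms(1)]])
  also have "\<dots> = 1" using assms(1) by (simp add: field_simps)
  finally show ?thesis .
qed

lemma upper_val_le_1_iff_Freq:
  assumes \<beta>: "\<beta> > 1" and \<alpha>: "\<alpha> > 0"
  shows "upper_val \<beta> \<alpha> \<le> 1 \<longleftrightarrow> \<alpha> \<le> Freq \<beta>"
proof (cases "\<beta> \<in> \<int>")
  case True
  then have "Freq \<beta> = \<beta> - 1" by (simp add: Freq_def)
  then show ?thesis
    using upper_val_int[OF \<beta> True] upper_val_strict_mono[OF \<beta>, of \<alpha> "\<beta> - 1"]
      upper_val_strict_mono[OF \<beta>, of "\<beta> - 1" \<alpha>]
    by (cases \<alpha> "\<beta> - 1" rule: linorder_cases) auto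
next
  case False
  obtain a where a: "a > 0" "\<And>\<alpha>. \<alpha> > 0 \<Longrightarrow> upper_val \<beta> \<alpha> \<le> 1 \<longleftrightarrow> \<alpha> \<le> a" "1 - 1 / \<beta> \<le> lower_val \<beta> a"
    using maximal_slope[OF \<beta>] by metis
  then have "Freq \<beta> = a" using Freq_eq[OF \<beta> a(1) _ a(3) False] by simp
  then show ?thesis using a(2)[OF \<alpha>] by simp
qed

theorem theorem4p10:
  shows "(\<forall>\<beta>>1. (\<forall>\<alpha>. 0 < \<alpha> \<and> \<alpha> \<le> Freq \<beta> \<longrightarrow> Xi_well_defined \<alpha> \<beta>) \<and>
                 (\<forall>\<alpha>. 0 < \<alpha> \<and> \<alpha> > Freq \<beta> \<longrightarrow> \<not> Xi_well_defined \<alpha> \<beta>)) \<and>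
         (\<forall>\<alpha>>0. (\<forall>\<beta>. \<beta> \<ge> Delta \<alpha> \<longrightarrow> Xi_well_defined \<alpha> \<beta>) \<and>
                 (\<forall>\<beta>. 1 < \<beta> \<and> \<beta> < Delta \<alpha> \<longrightarrow> \<not> Xi_well_defined \<alpha> \<beta>)) \<and>
         (\<forall>\<beta>>1. \<forall>\<alpha>\<^sub>0. mechanical_word \<alpha>\<^sub>0 (dbar \<beta> 1) \<longrightarrow>
                 (\<forall>\<alpha>. 0 < \<alpha> \<and> \<alpha> \<le> \<alpha>\<^sub>0 \<longrightarrow> Xi_well_defined \<alpha> \<beta>))"
proof (intro conjI allI impI)
  fix \<beta> \<alpha> :: real assume "\<beta> > 1" "0 < \<alpha> \<and> \<alpha> \<le> Freq \<beta>"
  then show "Xi_well_defined \<alpha> \<beta>" by (simp add: Xi_well_defined_iff upper_val_le_1_iff_Freq)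
next
  fix \<beta> \<alpha> :: real assume "\<beta> > 1" "0 < \<alpha> \<and> \<alpha> > Freq \<beta>"
  then show "\<not> Xi_well_defined \<alpha> \<beta>" by (simp add: Xi_well_defined_iff upper_val_le_1_iff_Freq)
next
  fix \<alpha> \<beta> :: real assume "\<alpha> > 0" "\<beta> \<ge> Delta \<alpha>"
  moreover have "\<beta> > 1" using calculation Delta_props(1)[of \<alpha>] by simp
  ultimately show "Xi_well_defined \<alpha> \<beta>" by (simp add: Xi_well_defined_iff upper_val_le_1_iff_Delta)
next
  fix \<alpha> \<beta> :: real assume "\<alpha> > 0" "1 < \<beta> \<and> \<beta> < Delta \<alpha>"
  then show "\<not> Xi_well_defined \<alpha> \<beta>" by (simp add: Xi_well_defined_iff upper_val_le_1_iff_Delta)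
next
  fix \<beta> \<alpha>\<^sub>0 \<alpha> :: real
  assume *: "\<beta> > 1" "mechanical_word \<alpha>\<^sub>0 (dbar \<beta> 1)" "0 < \<alpha> \<and> \<alpha> \<le> \<alpha>\<^sub>0"
  \<comment> \<open>Admissible slopes are closed downwards, so it is enough to admit
    \<open>\<alpha>\<^sub>0\<close>.\<close>
  have "upper_val \<beta> \<alpha> \<le> upper_val \<beta> \<alpha>\<^sub>0"
    using upper_val_strict_mono[OF *(1), of \<alpha> \<alpha>\<^sub>0] *(3) by (cases "\<alpha> = \<alpha>\<^sub>0") auto
  also have "\<dots> \<le> 1" by (rule mechanical_imp_upper_val_le_1[OF *(1,2)])
  finally show "Xi_well_defined \<alpha> \<beta>" using * by (simp add: Xi_well_defined_iff)
qed

end
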